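(* Let $n,Q\ge 1$ be integers, let $f=(f_1,\dots,f_Q)$ satisfy $f_a>0$ for all $a$ and $\sum_{a=1}^Q f_a=1$, and let $\pi=(\pi_{a,b})_{1\le a,b\le Q}$ be a symmetric matrix with entries in $[0,1]$. Let $G$ be a fixed strictly balanced graph with $v(G)$ vertices and $e(G)>1$ edges and without isolated vertices, and let $W$ be the number of (not necessarily induced) copies of $G$ in the stochastic block model $SBM(n,\pi,f)$. Put $$\pi^*=\max_{1\le a\le b\le Q}\pi_{a,b},\qquad \lambda=\mathbb{E}W=\binom{n}{v(G)}\rho(G)\mu(G),$$ where $$\mu(G)=\sum_{c_1,\dots,c_{v(G)}=1}^{Q} f_{c_1}f_{c_2}\cdots f_{c_{v(G)}}\prod_{1\le u<v\le v(G):\,(u,v)\in E(G)}\pi_{c_u,c_v}.$$ Then $$d_{TV}(\mathcal{L}(W),Po(\lambda))\le (1-e^{-\lambda})\rho(G)\bigg\{2\frac{v(G)^2}{v(G)!}n^{v(G)-1}(\pi^* )^{e(G)}+\pi^*+\sum_{s=2}^{v(G)-1}\binom{v(G)}{s}\frac{n^{v(G)-s}(\pi^* )^{\kappa(G,s)}}{(v(G)-s)!}\bigg\},$$ where $$\kappa(G,s)=\max\big(e(G)-s\,d(G)+\gamma(G),\ (v(G)-s)\,\alpha(G)\big).$$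
   Context: All graphs are finite, undirected, without self-loops or multiple edges. For a graph $H$, $v(H)$ and $e(H)$ denote its numbers of vertices and edges, $V(H)$ and $E(H)$ its vertex and edge sets, and $d(H)=e(H)/v(H)$. The vertex set of the fixed graph $G$ is identified with $\{1,\dots,v(G)\}$. $G$ is strictly balanced if $d(H)<d(G)$ for all (nonempty) subgraphs $H\subsetneq G$. Define $$\rho(G)=\frac{v(G)!}{a(G)},$$ where $a(G)$ is the number of automorphisms of $G$, and $$\alpha(G)=\min_H\frac{e(G)-e(H)}{v(G)-v(H)},\qquad \gamma(G)=\min_H\big(d(G)v(H)-e(H)\big),$$ where both minima are over all nonempty subgraphs $H\subsetneq G$ without isolated vertices (in the definition of $\alpha(G)$, subgraphs with $v(H)=v(G)$ contribute $+\infty$, i.e. are ignored). Stochastic block model $SBM(n,\pi,f)$: a random graph on vertex set $\{1,\dots,n\}$. Each vertex is independently assigned a class in $\{1,\dots,Q\}$, class $a$ having probability $f_a$. Conditionally on the classes, the edge indicators $Y_{i,j}$, $1\le i<j\le n$, are independent, and $\mathbb{P}(Y_{i,j}=1\mid i\in a,\ j\in b)=\pi_{a,b}$. Copies: let $\Gamma$ be the set of $v(G)$-element subsets of $\{1,\dots,n\}$ (so $|\Gamma|=\binom{n}{v(G)}$). For $\alpha\in\Gamma$ let $R_\alpha(G)$ be the set of all subgraphs of the complete graph on $\alpha$ that are isomorphic to $G$ (so $|R_\alpha(G)|=\rho(G)$). For $G'\in R_\alpha(G)$ let $X_\alpha(G')$ be the indicator that all edges of $G'$ are present in the random graph. Then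 $W=\sum_{\alpha\in\Gamma}\sum_{G'\in R_\alpha(G)}X_\alpha(G')$. $\mathcal{L}(W)$ is the law of $W$, $Po(\lambda)$ is the Poisson distribution with mean $\lambda$, and for nonnegative integer-valued random variables $d_{TV}(\mathcal{L}(U),\mathcal{L}(V))=\sup_{A\subseteq\mathbb{Z}^+}|\mathbb{P}(U\in A)-\mathbb{P}(V\in A)|$, where $\mathbb{Z}^+=\{0,1,2,\dots\}$. *)

theory Defs
  imports "HOL-Probability.Probability" "HOL-Probability.Product_PMF"
    "HOL-Combinatorics.Permutations" "HOL-Library.Ramsey" "HOL-Library.FuncSet"
begin

section \<open>Finite simple graphs\<close>

datatype 'a graph = Graph (verts: "'a set") (edges: "'a set set")

definition simple_graph :: "'a graph \<Rightarrow> bool" where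
  "simple_graph H \<longleftrightarrow> finite (verts H) \<and> edges H \<subseteq> nsets (verts H) 2"

definition num_verts :: "'a graph \<Rightarrow> nat" where
  "num_verts H = card (verts H)"

definition num_edges :: "'a graph \<Rightarrow> nat" where
  "num_edges H = card (edges H)"

definition edge_density :: "'a graph \<Rightarrow> real" where
  "edge_density H = real (num_edges H) / real (num_verts H)"

definition complete_graph :: "'a set \<Rightarrow> 'a graph" where
  "complete_graph A = Graph A (nsets A 2)"

definition subgraph :: "'a graph \<Rightarrow> 'a graph \<Rightarrow> bool" where
  "subgraph H G \<longleftrightarrow> simple_graph H \<and> verts H \<subseteq> verts G \<and> edges H \<subseteq> edges G"

definition no_isolated_verts :: "'a graph \<Rightarrow> bool" where
  "no_isolated_verts H \<longleftrightarrow> (\<forall>x\<in>verts H. \<exists>e\<in>edges H. x \<in> e)"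

definition graph_iso :: "'a graph \<Rightarrow> 'b graph \<Rightarrow> bool" where
  "graph_iso G H \<longleftrightarrow>
     (\<exists>\<phi>. bij_betw \<phi> (verts G) (verts H) \<and> (\<lambda>e. \<phi> ` e) ` edges G = edges H)"

definition strictly_balanced :: "'a graph \<Rightarrow> bool" where
  "strictly_balanced G \<longleftrightarrow>
     (\<forall>H. subgraph H G \<and> verts H \<noteq> {} \<and> H \<noteq> G \<longrightarrow> edge_density H < edge_density G)"

definition num_automorphisms :: "'a graph \<Rightarrow> nat" where
  "num_automorphisms G =
     card {\<sigma>. \<sigma> permutes verts G \<and> (\<lambda>e. \<sigma> ` e) ` edges G = edges G}"

definition rho :: "'a graph \<Rightarrow> real" where
  "rho G = fact (num_verts G) / real (num_automorphisms G)"

definition proper_subgraphs :: "'a graph \<Rightarrow> 'a graph set" where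
  "proper_subgraphs G =
     {H. subgraph H G \<and> H \<noteq> G \<and> verts H \<noteq> {} \<and> no_isolated_verts H}"

text \<open>
  In \<open>alpha\<close>, subgraphs on all vertices of \<open>G\<close> count as \<open>+\<infinity>\<close> and are therefore
  left out. Both minima range over nonempty sets as soon as \<open>G\<close> has at least two edges.
\<close>

definition alpha :: "'a graph \<Rightarrow> real" where
  "alpha G = Min ((\<lambda>H. (real (num_edges G) - real (num_edges H)) /
                          (real (num_verts G) - real (num_verts H)))
                    ` {H \<in> proper_subgraphs G. num_verts H \<noteq> num_verts G})"

definition gamma :: "'a graph \<Rightarrow> real" where
  "gamma G = Min ((\<lambda>H. edge_density G * real (num_verts H) - real (num_edges H))
                    ` proper_subgraphs G)"

definition kappa :: "'a graph \<Rightarrow> nat \<Rightarrow> real" where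
  "kappa G s = max (real (num_edges G) - real s * edge_density G + gamma G)
                   ((real (num_verts G) - real s) * alpha G)"


section \<open>The stochastic block model\<close>

text \<open>
  \<open>class_pmf Q f\<close> is meaningful when \<open>f\<close> is a probability vector on \<open>{1..Q}\<close>
  (see \<open>pmf_class_pmf\<close>); the values of \<open>f\<close> outside \<open>{1..Q}\<close> are irrelevant.
\<close>

definition class_pmf :: "nat \<Rightarrow> (nat \<Rightarrow> real) \<Rightarrow> nat pmf" where
  "class_pmf Q f = embed_pmf (\<lambda>a. if a \<in> {1..Q} then f a else 0)"

lemma pmf_class_pmf:
  assumes "\<And>a. a \<in> {1..Q} \<Longrightarrow> f a \<ge> 0" and "(\<Sum>a = 1..Q. f a) = 1"
  shows "pmf (class_pmf Q f) a = (if a \<in> {1..Q} then f a else 0)"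
  unfolding class_pmf_def
proof (rule pmf_embed_pmf)
  show "0 \<le> (if x \<in> {1..Q} then f x else 0)" for x
    using assms(1) by simp
  have "(\<integral>\<^sup>+x. ennreal (if x \<in> {1..Q} then f x else 0) \<partial>count_space UNIV)
      = (\<Sum>x\<in>{1..Q}. ennreal (if x \<in> {1..Q} then f x else 0))"
    by (rule nn_integral_count_space') (auto split: if_splits)
  also have "\<dots> = ennreal (\<Sum>x\<in>{1..Q}. f x)"
    using assms(1) by (subst sum_ennreal [symmetric]) auto
  finally show "(\<integral>\<^sup>+x. ennreal (if x \<in> {1..Q} then f x else 0) \<partial>count_space UNIV) = 1"
    using assms(2) by simp
qed

definition vertex_pairs :: "nat \<Rightarrow> (nat \<times> nat) set" where
  "vertex_pairs n = {(i, j). 1 \<le> i \<and> i < j \<and> j \<le> n}"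

text \<open>
  \<open>c\<close> is the vector of classes and \<open>Y (i, j)\<close>, for \<open>i < j\<close>, the edge indicator;
  both are filled with a dummy value outside their index sets.
\<close>

definition SBM :: "nat \<Rightarrow> nat \<Rightarrow> (nat \<Rightarrow> nat \<Rightarrow> real) \<Rightarrow> (nat \<Rightarrow> real) \<Rightarrow> nat graph pmf" where
  "SBM n Q \<pi> f =
     bind_pmf (Pi_pmf {1..n} 0 (\<lambda>_. class_pmf Q f)) (\<lambda>c.
     bind_pmf (Pi_pmf (vertex_pairs n) False (\<lambda>(i, j). bernoulli_pmf (\<pi> (c i) (c j)))) (\<lambda>Y.
     return_pmf (Graph {1..n} {{i, j} | i j. (i, j) \<in> vertex_pairs n \<and> Y (i, j)})))"

definition max_prob :: "nat \<Rightarrow> (nat \<Rightarrow> nat \<Rightarrow> real) \<Rightarrow> real" where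
  "max_prob Q \<pi> = Max {\<pi> a b | a b. 1 \<le> a \<and> a \<le> b \<and> b \<le> Q}"

definition mu :: "nat \<Rightarrow> (nat \<Rightarrow> nat \<Rightarrow> real) \<Rightarrow> (nat \<Rightarrow> real) \<Rightarrow> nat graph \<Rightarrow> real" where
  "mu Q \<pi> f G =
     (\<Sum>c \<in> {1..num_verts G} \<rightarrow>\<^sub>E {1..Q}.
        (\<Prod>u = 1..num_verts G. f (c u)) *
        (\<Prod>(u, v) \<in> {(u, v). (u, v) \<in> vertex_pairs (num_verts G) \<and> {u, v} \<in> edges G}.
           \<pi> (c u) (c v)))"


section \<open>Copies and their law\<close>

definition copies_on :: "'a graph \<Rightarrow> 'b set \<Rightarrow> 'b graph set" where
  "copies_on G A = {G'. subgraph G' (complete_graph A) \<and> graph_iso G' G}"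

definition num_copies :: "'a graph \<Rightarrow> 'b graph \<Rightarrow> nat" where
  "num_copies G H =
     (\<Sum>A \<in> nsets (verts H) (num_verts G). \<Sum>G' \<in> copies_on G A. of_bool (edges G' \<subseteq> edges H))"

definition copies_pmf ::
    "nat \<Rightarrow> nat \<Rightarrow> (nat \<Rightarrow> nat \<Rightarrow> real) \<Rightarrow> (nat \<Rightarrow> real) \<Rightarrow> nat graph \<Rightarrow> nat pmf" where
  "copies_pmf n Q \<pi> f G = map_pmf (num_copies G) (SBM n Q \<pi> f)"

text \<open>\<open>poisson_pmf\<close> is only specified for positive rates; \<open>Po(0)\<close> is the point mass at 0.\<close>

definition Po :: "real \<Rightarrow> nat pmf" where
  "Po l = (if l = 0 then return_pmf 0 else poisson_pmf l)"

definition d_TV :: "nat pmf \<Rightarrow> nat pmf \<Rightarrow> real" where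
  "d_TV p q = (SUP A. \<bar>measure_pmf.prob p A - measure_pmf.prob q A\<bar>)"

end

theory Submission
  imports Defs
begin

text \<open>
  Write the count as \<open>W = (\<Sum>K. X K)\<close>, where \<open>K\<close> runs over the copies of \<open>G\<close> in the complete graph on
  \<open>{1..n}\<close> and \<open>X K\<close> indicates that all edges of \<open>K\<close> are present. Two facts about the block model
  make \<open>W\<close> nearly Poisson.

  First, \<open>X K\<close> is determined by the classes and the edge variables inside \<open>verts K\<close>, so it is
  independent of all copies that avoid \<open>verts K\<close> (\<open>expect_indep\<close>). The Stein--Chen method for local
  dependence (\<open>stein_chen_local\<close>) then bounds the total variation distance by
  \<open>(1 - exp (- l)) / l\<close> times the sum, over pairs \<open>K, L\<close> sharing at least one vertex, of
  \<open>P(X K) P(X L)\<close>, plus \<open>P(X K \<and> X L)\<close> when \<open>K \<noteq> L\<close>. The factor comes from the Lipschitz constant of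
  the solution of the Stein equation (\<open>stein_solution_lipschitz\<close>).

  Second, given the classes the edges are independent and each has probability at most \<open>max_prob\<close>.
  Hence \<open>P(X K \<and> X L)\<close> is at most \<open>P(X K)\<close> times \<open>max_prob\<close> to the number of edges that \<open>L\<close> has in
  addition to \<open>K\<close> (\<open>edges_prob_Un_le\<close>). All copies have the same probability \<open>mu\<close>
  (\<open>edges_prob_relabel\<close>) and every vertex set of the right size carries exactly \<open>rho\<close> copies
  (\<open>card_copies_on\<close>), so \<open>l\<close> is the number of copies times \<open>mu\<close>. This cancels the \<open>1 / l\<close> and leaves,
  for one fixed \<open>K\<close>, a sum over the number \<open>s\<close> of vertices that \<open>L\<close> shares with \<open>K\<close>. If \<open>s = 1\<close> no edge
  is shared; together with the products \<open>P(X K) P(X L)\<close> this gives the term with the factor 2. If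
  \<open>s = v(G)\<close>, distinct copies differ in at least one edge, which gives the single factor \<open>max_prob\<close>.
  Otherwise the shared edges form a copy of a proper subgraph of \<open>G\<close> on at most \<open>s\<close> vertices, and the
  definitions of \<open>alpha\<close> and \<open>gamma\<close> say that \<open>L\<close> has at least \<open>kappa G s\<close> new edges
  (\<open>kappa_le_new_edges\<close>).
\<close>

section \<open>Poisson approximation under local dependence\<close>

text \<open>
  The usual Stein solution \<open>g\<close> for the event \<open>A\<close> satisfies \<open>r * g (k + 1) - k * g k = 1\<^sub>A k - Po r A\<close>,
  where \<open>g 0\<close> is arbitrary. Here \<open>stein_solution r A k\<close> is \<open>g (k + 1)\<close>: the shift removes the arbitrary
  value, and \<open>g k\<close> becomes the value at \<open>k - 1\<close>, whose factor \<open>k\<close> makes the case \<open>k = 0\<close> harmless.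
\<close>

definition stein_solution :: "real \<Rightarrow> nat set \<Rightarrow> nat \<Rightarrow> real" where
  "stein_solution r A k =
     (measure (poisson_pmf r) (A \<inter> {..k}) - measure (poisson_pmf r) A * measure (poisson_pmf r) {..k})
       / (r * pmf (poisson_pmf r) k)"

lemma pmf_poisson_Suc:
  assumes "r > 0"
  shows "real (Suc k) * pmf (poisson_pmf r) (Suc k) = r * pmf (poisson_pmf r) k"
proof -
  have "real (Suc k) * (r ^ Suc k / fact (Suc k)) = r * (r ^ k / fact k)"
    by (simp add: fact_Suc del: of_nat_Suc)
  thus ?thesis using assms by (simp only: pmf_poisson mult.assoc[symmetric])
qed

lemma measure_atMost_Suc:
  fixes q :: "nat pmf"
  shows "measure q (A \<inter> {..Suc m}) = measure q (A \<inter> {..m}) + measure q (A \<inter> {Suc m})"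
proof -
  have "A \<inter> {..Suc m} = (A \<inter> {..m}) \<union> (A \<inter> {Suc m})" by (auto simp: le_Suc_eq)
  thus ?thesis
    by (metis (no_types, lifting) finite_Int finite.emptyI finite_insert finite_atMost
        measure_pmf.finite_measure_Union sets_measure_pmf UNIV_I
        Int_assoc Int_commute Int_insert_right Int_empty_right atMost_iff not_less_eq_eq order_refl)
qed

lemma stein_equation:
  assumes "r > 0"
  shows "r * stein_solution r A k - real k * stein_solution r A (k - 1)
    = of_bool (k \<in> A) - measure (poisson_pmf r) A"
proof -
  let ?q = "poisson_pmf r"
  have pos: "pmf ?q k > 0" for k using assms by (simp add: pmf_positive)
  have single: "measure ?q (A \<inter> {k}) = of_bool (k \<in> A) * pmf ?q k" for k
    by (cases "k \<in> A") (auto simp: measure_pmf_single)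
  show ?thesis
  proof (cases k)
    case 0
    have "measure ?q {..0} = pmf ?q 0" by (simp add: measure_pmf_single)
    moreover have "measure ?q (A \<inter> {..0}) = of_bool (0 \<in> A) * pmf ?q 0"
      using single[of 0] by (simp add: atMost_0)
    ultimately show ?thesis using 0 pos[of 0] assms
      by (simp add: stein_solution_def field_simps del: pmf_poisson)
  next
    case (Suc m)
    have U: "measure ?q {..Suc m} = measure ?q {..m} + pmf ?q (Suc m)"
      using measure_atMost_Suc[of ?q UNIV m] by (simp add: measure_pmf_single)
    have "real (Suc m) * stein_solution r A m
      = (measure ?q (A \<inter> {..m}) - measure ?q A * measure ?q {..m}) / pmf ?q (Suc m)"
      unfolding stein_solution_def pmf_poisson_Suc[OF assms, symmetric]
      using pos[of "Suc m"] by (simp del: pmf_poisson of_nat_Suc)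
    moreover have "r * stein_solution r A (Suc m)
      = (measure ?q (A \<inter> {..Suc m}) - measure ?q A * measure ?q {..Suc m}) / pmf ?q (Suc m)"
      unfolding stein_solution_def using assms by (simp del: pmf_poisson)
    ultimately show ?thesis
      unfolding Suc measure_atMost_Suc[of _ A] U single diff_Suc_1
      using pos[of "Suc m"]
      by (simp only: diff_divide_distrib[symmetric]) (simp add: field_simps del: pmf_poisson of_nat_Suc)
  qed
qed

text \<open>
  By \<open>r p\<^sub>i = (i + 1) p\<^sub>i\<^sub>+\<^sub>1\<close> the left-hand side is \<open>(\<Sum>j = 1..m+1. j * p\<^sub>j)\<close>; each factor \<open>j\<close> is at most
  \<open>m + 1\<close>, and the missing term \<open>p\<^sub>0 = exp (- r)\<close> is what later produces \<open>1 - exp (- r)\<close>.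
\<close>

lemma poisson_head_bound:
  assumes r: "r > 0"
  shows "r * measure (poisson_pmf r) {..m}
      \<le> real (Suc m) * (measure (poisson_pmf r) {..Suc m} - exp (- r))"
proof -
  let ?p = "pmf (poisson_pmf r)"
  have "r * measure (poisson_pmf r) {..m} = (\<Sum>i\<le>m. r * ?p i)"
    by (simp add: measure_measure_pmf_finite sum_distrib_left del: pmf_poisson)
  also have "\<dots> = (\<Sum>i\<le>m. real (Suc i) * ?p (Suc i))"
    by (simp only: pmf_poisson_Suc[OF r])
  also have "\<dots> \<le> (\<Sum>i\<le>m. real (Suc m) * ?p (Suc i))"
    by (intro sum_mono mult_right_mono) (auto simp del: pmf_poisson)
  also have "\<dots> = real (Suc m) * ((\<Sum>i\<le>Suc m. ?p i) - ?p 0)"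
    by (subst sum.atMost_Suc_shift) (simp add: sum_distrib_left del: pmf_poisson of_nat_Suc)
  also have "\<dots> = real (Suc m) * (measure (poisson_pmf r) {..Suc m} - exp (- r))"
    using r by (simp add: measure_measure_pmf_finite)
  finally show ?thesis .
qed

text \<open>
  The counterpart for upper tails: \<open>r p\<^sub>i\<close> with \<open>i > m\<close> equals \<open>(i + 1) p\<^sub>i\<^sub>+\<^sub>1\<close>, where now \<open>i + 1 \<ge> m + 1\<close>.
\<close>

lemma poisson_tail_bound:
  assumes r: "r > 0"
  shows "real (Suc m) * (1 - measure (poisson_pmf r) {..Suc m})
      \<le> r * (1 - measure (poisson_pmf r) {..m})"
proof -
  let ?p = "pmf (poisson_pmf r)"
  have "(\<lambda>k. r ^ k / fact k * exp (- r)) sums (exp r * exp (- r))"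
    using exp_converges[of r] by (intro sums_mult2) (simp add: field_simps)
  hence "(\<lambda>k. r ^ k / fact k * exp (- r)) sums 1"
    by (simp only: exp_minus right_inverse exp_not_eq_zero not_False_eq_True)
  moreover have "?p = (\<lambda>k. r ^ k / fact k * exp (- r))"
    using r by (intro ext) (simp only: pmf_poisson)
  ultimately have sums: "?p sums 1" by simp
  have tail: "1 - measure (poisson_pmf r) {..m} = (\<Sum>i. ?p (i + Suc m))" for m
    using suminf_minus_initial_segment[OF sums_summable[OF sums], of "Suc m"] sums_unique[OF sums]
    by (simp add: measure_measure_pmf_finite lessThan_Suc_atMost del: pmf_poisson)
  have summ: "summable (\<lambda>i. ?p (i + k))" for k
    using summable_iff_shift[of ?p k] sums_summable[OF sums] by blast
  have "real (Suc m) * (\<Sum>i. ?p (i + Suc (Suc m))) = (\<Sum>i. real (Suc m) * ?p (i + Suc (Suc m)))"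
    by (rule suminf_mult[OF summ, symmetric])
  also have "\<dots> \<le> (\<Sum>i. r * ?p (i + Suc m))"
  proof (rule suminf_le)
    fix i
    have "real (Suc m) * ?p (i + Suc (Suc m)) \<le> real (Suc (i + Suc m)) * ?p (Suc (i + Suc m))"
      by (simp only: add_Suc_right, intro mult_right_mono) (auto simp del: pmf_poisson)
    thus "real (Suc m) * ?p (i + Suc (Suc m)) \<le> r * ?p (i + Suc m)"
      by (simp only: pmf_poisson_Suc[OF r])
  qed (intro summable_mult summ)+
  also have "\<dots> = r * (\<Sum>i. ?p (i + Suc m))"
    by (rule suminf_mult[OF summ])
  finally show ?thesis by (simp only: tail)
qed

text \<open>
  With \<open>k = m + 1\<close>, split the mass of \<open>A\<close> into \<open>L\<close> below \<open>k\<close>, \<open>M\<close> at \<open>k\<close> and \<open>R\<close> above \<open>k\<close>. The increment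
  is linear in these three numbers. The coefficients of \<open>L\<close> and \<open>R\<close> are nonpositive by the tail and the
  head bound, so only \<open>M\<close>, which is at most \<open>p\<^sub>k\<close>, can contribute.
\<close>

lemma stein_solution_increment_le:
  assumes r: "r > 0"
  shows "stein_solution r A (Suc m) - stein_solution r A m \<le> (1 - exp (- r)) / r"
proof -
  let ?q = "poisson_pmf r"
  define k L M R U p where "k = real (Suc m)" and "L = measure ?q (A \<inter> {..m})"
    and "M = measure ?q (A \<inter> {Suc m})" and "R = measure ?q (A \<inter> {Suc m<..})"
    and "U = measure ?q {..m}" and "p = pmf ?q (Suc m)"
  have p: "p > 0" using r unfolding p_def by (simp add: pmf_positive)
  have k: "k > 0" unfolding k_def by simp
  have LMR: "measure ?q A = L + M + R"
  proof -
    have "A = (A \<inter> {..Suc m}) \<union> (A \<inter> {Suc m<..})" by auto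
    hence "measure ?q A = measure ?q (A \<inter> {..Suc m}) + R"
      unfolding R_def by (subst measure_pmf.finite_measure_Union[symmetric]) auto
    thus ?thesis using measure_atMost_Suc[of ?q A m] by (simp add: L_def M_def)
  qed
  have U: "measure ?q {..Suc m} = U + p"
    using measure_atMost_Suc[of ?q UNIV m] by (simp add: measure_pmf_single U_def p_def del: pmf_poisson)
  have "M \<le> measure ?q {Suc m}" unfolding M_def by (rule measure_pmf.finite_measure_mono) auto
  hence M: "M \<le> p" "0 \<le> M" by (simp_all add: p_def M_def measure_pmf_single del: pmf_poisson)
  have nn: "0 \<le> L" "0 \<le> R" "0 \<le> U" by (simp_all add: L_def R_def U_def)
  have U1: "U + p \<le> 1" using U measure_pmf.prob_le_1[of ?q "{..Suc m}"] by simp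
  have head: "r * U \<le> k * (U + p - exp (- r))"
    using poisson_head_bound[OF r, of m] U by (simp add: k_def U_def)
  have tail: "k * (1 - U - p) \<le> r * (1 - U)"
    using poisson_tail_bound[OF r, of m] unfolding U by (simp add: k_def U_def algebra_simps)
  have h1: "stein_solution r A (Suc m) = (L + M - (L + M + R) * (U + p)) / (r * p)"
    using measure_atMost_Suc[of ?q A m]
    by (simp add: stein_solution_def U LMR L_def M_def p_def del: pmf_poisson)
  have h2: "stein_solution r A m = (L - (L + M + R) * U) / (k * p)"
    unfolding stein_solution_def pmf_poisson_Suc[OF r, symmetric]
    by (simp add: LMR L_def U_def k_def p_def del: pmf_poisson)
  have "stein_solution r A (Suc m) - stein_solution r A m =
      L * ((1 - U - p) / (r * p) - (1 - U) / (k * p))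
      + M * ((1 - U - p) / (r * p) + U / (k * p))
      + R * (U / (k * p) - (U + p) / (r * p))"
    unfolding h1 h2 by (simp add: diff_divide_distrib add_divide_distrib ring_distribs)
  also have "\<dots> \<le> 0 + p * ((1 - U - p) / (r * p) + U / (k * p)) + 0"
  proof (intro add_mono)
    have "(1 - U - p) / r \<le> (1 - U) / k"
      using tail r k by (simp add: divide_le_eq le_divide_eq mult.commute)
    hence "(1 - U - p) / (r * p) \<le> (1 - U) / (k * p)"
      using p divide_right_mono[of _ _ p] by (simp only: divide_divide_eq_left[symmetric] less_imp_le)
    thus "L * ((1 - U - p) / (r * p) - (1 - U) / (k * p)) \<le> 0"
      using nn by (intro mult_nonneg_nonpos) auto
    have "k * (U + p - exp (- r)) \<le> k * (U + p)" using k by simp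
    hence "r * U \<le> k * (U + p)" using head by linarith
    hence "U / k \<le> (U + p) / r"
      using r k by (simp add: divide_le_eq le_divide_eq mult.commute)
    hence "U / (k * p) \<le> (U + p) / (r * p)"
      using p divide_right_mono[of _ _ p] by (simp only: divide_divide_eq_left[symmetric] less_imp_le)
    thus "R * (U / (k * p) - (U + p) / (r * p)) \<le> 0"
      using nn by (intro mult_nonneg_nonpos) auto
    show "M * ((1 - U - p) / (r * p) + U / (k * p)) \<le> p * ((1 - U - p) / (r * p) + U / (k * p))"
      using M U1 nn p r k by (intro mult_right_mono add_nonneg_nonneg) auto
  qed
  also have "\<dots> = (1 - U - p) / r + U / k" using p r k by (simp add: field_simps)
  also have "\<dots> \<le> (1 - U - p) / r + (U + p - exp (- r)) / r"
    using head r k by (simp add: divide_le_eq le_divide_eq mult.commute)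
  also have "\<dots> = (1 - exp (- r)) / r" by (simp add: diff_divide_distrib add_divide_distrib)
  finally show ?thesis .
qed

text \<open>
  This turns the upper bound on increments into a two-sided one.
\<close>

lemma stein_solution_Compl: "stein_solution r (- A) k = - stein_solution r A k"
proof -
  let ?q = "poisson_pmf r"
  have 1: "measure ?q {..k} = measure ?q (A \<inter> {..k}) + measure ?q (- A \<inter> {..k})"
    by (subst measure_pmf.finite_measure_Union[symmetric]) (auto intro!: arg_cong[of _ _ "measure ?q"])
  have 2: "measure ?q (- A) = 1 - measure ?q A"
    using measure_pmf.prob_compl[of A ?q] by (simp add: Compl_eq_Diff_UNIV)
  have "measure ?q (- A \<inter> {..k}) - measure ?q (- A) * measure ?q {..k}
      = - (measure ?q (A \<inter> {..k}) - measure ?q A * measure ?q {..k})"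
    unfolding 1 2 by (simp only: ring_distribs mult_1_left)
  thus ?thesis unfolding stein_solution_def by (simp only: minus_divide_left)
qed

lemma stein_solution_lipschitz:
  assumes r: "r > 0" and "a \<le> b"
  shows "\<bar>stein_solution r A b - stein_solution r A a\<bar> \<le> (1 - exp (- r)) / r * real (b - a)"
  using \<open>a \<le> b\<close>
proof (induction b rule: dec_induct)
  case (step b)
  have "\<bar>stein_solution r A (Suc b) - stein_solution r A b\<bar> \<le> (1 - exp (- r)) / r"
    using stein_solution_increment_le[OF r, of A b] stein_solution_increment_le[OF r, of "- A" b]
    by (simp add: stein_solution_Compl abs_le_iff)
  hence "\<bar>stein_solution r A (Suc b) - stein_solution r A a\<bar>
    \<le> (1 - exp (- r)) / r + (1 - exp (- r)) / r * real (b - a)"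
    using step.IH by linarith
  also have "\<dots> = (1 - exp (- r)) / r * real (Suc b - a)"
    using step.hyps by (simp add: Suc_diff_le ring_distribs)
  finally show ?case .
qed simp

text \<open>
  For indicators \<open>X i\<close> with sum \<open>W\<close>, let \<open>h\<close> be the Stein solution. The Stein equation reduces the claim
  to \<open>E(r h(W) - W h(W - 1))\<close>. On \<open>X i\<close> the value \<open>W - 1\<close> is the sum \<open>W' i\<close> of the other indicators, so
  this equals the sum over \<open>i\<close> of \<open>P i * E h(W) - E(X i h(W' i))\<close>. Replacing both arguments by the sum
  \<open>V i\<close> over the complement of the neighbourhood \<open>N i\<close> makes the two terms equal by independence,
  at a cost controlled by the Lipschitz constant and the number of indicators dropped.
\<close>

theorem stein_chen_local:
  fixes M :: "'a pmf" and X :: "'i \<Rightarrow> 'a \<Rightarrow> bool" and N :: "'i \<Rightarrow> 'i set"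
  defines "P \<equiv> \<lambda>i. measure_pmf.expectation M (\<lambda>\<omega>. of_bool (X i \<omega>))"
  assumes fin: "finite (set_pmf M)" "finite I"
    and N: "\<And>i. i \<in> I \<Longrightarrow> i \<in> N i \<and> N i \<subseteq> I"
    and indep: "\<And>i (g :: nat \<Rightarrow> real). i \<in> I \<Longrightarrow>
      measure_pmf.expectation M (\<lambda>\<omega>. of_bool (X i \<omega>) * g (card {j \<in> I - N i. X j \<omega>}))
      = P i * measure_pmf.expectation M (\<lambda>\<omega>. g (card {j \<in> I - N i. X j \<omega>}))"
    and r: "r = (\<Sum>i\<in>I. P i)" "r > 0"
  shows "\<bar>measure (map_pmf (\<lambda>\<omega>. card {i \<in> I. X i \<omega>}) M) A - measure (poisson_pmf r) A\<bar>
    \<le> (1 - exp (- r)) / r *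
      (\<Sum>i\<in>I. P i * (\<Sum>j\<in>N i. P j)
         + (\<Sum>j\<in>N i - {i}. measure_pmf.expectation M (\<lambda>\<omega>. of_bool (X i \<omega> \<and> X j \<omega>))))"
proof -
  define E :: "('a \<Rightarrow> real) \<Rightarrow> real" where "E = measure_pmf.expectation M"
  have int: "integrable (measure_pmf M) f" for f :: "'a \<Rightarrow> real"
    by (rule integrable_measure_pmf_finite[OF fin(1)])
  have E_add: "E (\<lambda>\<omega>. f \<omega> + g \<omega>) = E f + E g" for f g
    unfolding E_def by (intro Bochner_Integration.integral_add int)
  have E_diff: "E (\<lambda>\<omega>. f \<omega> - g \<omega>) = E f - E g" for f g
    unfolding E_def by (intro Bochner_Integration.integral_diff int)
  have E_sum: "E (\<lambda>\<omega>. \<Sum>i\<in>J. f i \<omega>) = (\<Sum>i\<in>J. E (f i))" for f and J :: "'i set"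
    unfolding E_def by (intro Bochner_Integration.integral_sum int)
  have E_cmult: "E (\<lambda>\<omega>. c * f \<omega>) = c * E f" for c f
    unfolding E_def by simp
  have E_mono: "E f \<le> E g" if "\<And>\<omega>. f \<omega> \<le> g \<omega>" for f g
    unfolding E_def by (intro integral_mono int that)
  have E_abs: "\<bar>E f\<bar> \<le> E (\<lambda>\<omega>. \<bar>f \<omega>\<bar>)" for f
    unfolding E_def by (rule integral_abs_bound)
  have P_nonneg: "P i \<ge> 0" for i
    unfolding P_def by (intro integral_nonneg_AE) auto
  define h C where "h = stein_solution r A" and "C = (1 - exp (- r)) / r"
  have C: "C \<ge> 0" unfolding C_def using r(2) by simp
  define W where "W = (\<lambda>\<omega>. card {i \<in> I. X i \<omega>})"
  define W' where "W' = (\<lambda>i \<omega>. card {j \<in> I - {i}. X j \<omega>})"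
  define V where "V = (\<lambda>i \<omega>. card {j \<in> I - N i. X j \<omega>})"
  have count: "real (card {j \<in> J. X j \<omega>}) = (\<Sum>j\<in>J. of_bool (X j \<omega>))" if "finite J" for J \<omega>
    using that by (simp add: of_bool_def sum.If_cases Int_def conj_commute)
  have lip: "\<bar>h b - h a\<bar> \<le> C * real (b - a)" if "a \<le> b" for a b
    using stein_solution_lipschitz[OF r(2) that] by (simp add: h_def C_def)
  \<comment> \<open>Dropping the indicators in \<open>K\<close> from a sum changes \<open>h\<close> by at most \<open>C\<close> per dropped success.\<close>
  have lip_count: "\<bar>h (card {j \<in> J. X j \<omega>}) - h (card {j \<in> J - K. X j \<omega>})\<bar>
      \<le> C * (\<Sum>j\<in>K. of_bool (X j \<omega>))" if "finite J" "K \<subseteq> J" for J K \<omega>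
  proof -
    have finK: "finite K" using that finite_subset by blast
    have "{j \<in> J - K. X j \<omega>} = {j \<in> J. X j \<omega>} - {j \<in> K. X j \<omega>}" by auto
    moreover have "{j \<in> K. X j \<omega>} \<subseteq> {j \<in> J. X j \<omega>}" using that by auto
    ultimately have "card {j \<in> J - K. X j \<omega>} + card {j \<in> K. X j \<omega>} = card {j \<in> J. X j \<omega>}"
      using card_Diff_subset[of "{j \<in> K. X j \<omega>}" "{j \<in> J. X j \<omega>}"]
        card_mono[of "{j \<in> J. X j \<omega>}" "{j \<in> K. X j \<omega>}"] finK \<open>finite J\<close> by simp
    hence "card {j \<in> J - K. X j \<omega>} \<le> card {j \<in> J. X j \<omega>}"
      and "card {j \<in> J. X j \<omega>} - card {j \<in> J - K. X j \<omega>} = card {j \<in> K. X j \<omega>}" by simp_all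
    thus ?thesis using lip count[OF finK, of \<omega>] by metis
  qed
  have "measure (map_pmf W M) A - measure (poisson_pmf r) A
      = E (\<lambda>\<omega>. of_bool (W \<omega> \<in> A) - measure (poisson_pmf r) A)"
  proof -
    have "measure (map_pmf W M) A = E (\<lambda>\<omega>. of_bool (W \<omega> \<in> A))"
    proof -
      have "measure (map_pmf W M) A = measure_pmf.expectation (map_pmf W M) (indicator A)"
        by simp
      also have "\<dots> = E (\<lambda>\<omega>. of_bool (W \<omega> \<in> A))"
        unfolding E_def by (simp only: integral_map_pmf indicator_def)
      finally show ?thesis .
    qed
    thus ?thesis unfolding E_diff by (simp add: E_def)
  qed
  also have "\<dots> = E (\<lambda>\<omega>. r * h (W \<omega>) - real (W \<omega>) * h (W \<omega> - 1))"
    unfolding h_def by (simp only: stein_equation[OF r(2)])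
  also have "\<dots> = E (\<lambda>\<omega>. r * h (W \<omega>) - (\<Sum>i\<in>I. of_bool (X i \<omega>) * h (W' i \<omega>)))"
  proof (rule arg_cong[of _ _ E], rule ext)
    fix \<omega>
    have "real (W \<omega>) * h (W \<omega> - 1) = (\<Sum>i\<in>I. of_bool (X i \<omega>) * h (W \<omega> - 1))"
      by (simp add: W_def count[OF fin(2)] sum_distrib_right)
    also have "\<dots> = (\<Sum>i\<in>I. of_bool (X i \<omega>) * h (W' i \<omega>))"
    proof (rule sum.cong[OF refl])
      fix i assume i: "i \<in> I"
      show "of_bool (X i \<omega>) * h (W \<omega> - 1) = of_bool (X i \<omega>) * h (W' i \<omega>)"
      proof (cases "X i \<omega>")
        case True
        have "{j \<in> I - {i}. X j \<omega>} = {j \<in> I. X j \<omega>} - {i}" by auto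
        hence "W' i \<omega> = W \<omega> - 1" unfolding W_def W'_def using True i by simp
        thus ?thesis by simp
      qed simp
    qed
    finally show "r * h (W \<omega>) - real (W \<omega>) * h (W \<omega> - 1)
        = r * h (W \<omega>) - (\<Sum>i\<in>I. of_bool (X i \<omega>) * h (W' i \<omega>))" by simp
  qed
  also have "\<dots> = (\<Sum>i\<in>I. P i * E (\<lambda>\<omega>. h (W \<omega>)) - E (\<lambda>\<omega>. of_bool (X i \<omega>) * h (W' i \<omega>)))"
    by (simp only: E_diff E_cmult E_sum r(1) sum_distrib_right sum_subtractf)
  also have "\<dots> = (\<Sum>i\<in>I. P i * E (\<lambda>\<omega>. h (W \<omega>) - h (V i \<omega>))
      - E (\<lambda>\<omega>. of_bool (X i \<omega>) * (h (W' i \<omega>) - h (V i \<omega>))))"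
  proof (rule sum.cong[OF refl])
    fix i assume "i \<in> I"
    from indep[OF this, of h]
    have "E (\<lambda>\<omega>. of_bool (X i \<omega>) * h (V i \<omega>)) = P i * E (\<lambda>\<omega>. h (V i \<omega>))"
      by (simp add: E_def V_def)
    thus "P i * E (\<lambda>\<omega>. h (W \<omega>)) - E (\<lambda>\<omega>. of_bool (X i \<omega>) * h (W' i \<omega>))
      = P i * E (\<lambda>\<omega>. h (W \<omega>) - h (V i \<omega>))
        - E (\<lambda>\<omega>. of_bool (X i \<omega>) * (h (W' i \<omega>) - h (V i \<omega>)))"
      by (simp add: E_diff right_diff_distrib)
  qed
  \<comment> \<open>\<open>E (X i * h (V i)) = P i * E (h (V i))\<close> has been subtracted from and added to each summand.\<close>
  finally have repr: "measure (map_pmf W M) A - measure (poisson_pmf r) A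
    = (\<Sum>i\<in>I. P i * E (\<lambda>\<omega>. h (W \<omega>) - h (V i \<omega>))
      - E (\<lambda>\<omega>. of_bool (X i \<omega>) * (h (W' i \<omega>) - h (V i \<omega>))))" .
  have "\<bar>measure (map_pmf W M) A - measure (poisson_pmf r) A\<bar>
    \<le> (\<Sum>i\<in>I. C * (P i * (\<Sum>j\<in>N i. P j)
         + (\<Sum>j\<in>N i - {i}. E (\<lambda>\<omega>. of_bool (X i \<omega> \<and> X j \<omega>)))))"
    unfolding repr
  proof (rule order_trans[OF sum_abs], rule sum_mono)
    fix i assume i: "i \<in> I"
    have "\<bar>E (\<lambda>\<omega>. h (W \<omega>) - h (V i \<omega>))\<bar> \<le> E (\<lambda>\<omega>. C * (\<Sum>j\<in>N i. of_bool (X j \<omega>)))"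
      using lip_count[OF fin(2), of "N i"] N[OF i]
      by (intro order_trans[OF E_abs] E_mono) (simp add: W_def V_def)
    also have "\<dots> = C * (\<Sum>j\<in>N i. P j)"
      by (simp only: E_cmult E_sum) (simp add: P_def E_def)
    finally have 1: "\<bar>P i * E (\<lambda>\<omega>. h (W \<omega>) - h (V i \<omega>))\<bar> \<le> P i * (C * (\<Sum>j\<in>N i. P j))"
      using P_nonneg by (simp add: abs_mult mult_left_mono)
    have "\<bar>E (\<lambda>\<omega>. of_bool (X i \<omega>) * (h (W' i \<omega>) - h (V i \<omega>)))\<bar>
      \<le> E (\<lambda>\<omega>. C * (\<Sum>j\<in>N i - {i}. of_bool (X i \<omega> \<and> X j \<omega>)))"
    proof (intro order_trans[OF E_abs] E_mono)
      fix \<omega>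
      have "I - {i} - (N i - {i}) = I - N i" using N[OF i] by auto
      hence "\<bar>h (W' i \<omega>) - h (V i \<omega>)\<bar> \<le> C * (\<Sum>j\<in>N i - {i}. of_bool (X j \<omega>))"
        using lip_count[of "I - {i}" "N i - {i}" \<omega>] N[OF i] fin(2)
        by (simp add: W'_def V_def Diff_mono)
      thus "\<bar>of_bool (X i \<omega>) * (h (W' i \<omega>) - h (V i \<omega>))\<bar>
        \<le> C * (\<Sum>j\<in>N i - {i}. of_bool (X i \<omega> \<and> X j \<omega>))"
        by (cases "X i \<omega>") auto
    qed
    also have "\<dots> = C * (\<Sum>j\<in>N i - {i}. E (\<lambda>\<omega>. of_bool (X i \<omega> \<and> X j \<omega>)))"
      by (simp only: E_cmult E_sum)
    finally have 2: "\<bar>E (\<lambda>\<omega>. of_bool (X i \<omega>) * (h (W' i \<omega>) - h (V i \<omega>)))\<bar>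
      \<le> C * (\<Sum>j\<in>N i - {i}. E (\<lambda>\<omega>. of_bool (X i \<omega> \<and> X j \<omega>)))" .
    show "\<bar>P i * E (\<lambda>\<omega>. h (W \<omega>) - h (V i \<omega>))
        - E (\<lambda>\<omega>. of_bool (X i \<omega>) * (h (W' i \<omega>) - h (V i \<omega>)))\<bar>
      \<le> C * (P i * (\<Sum>j\<in>N i. P j) + (\<Sum>j\<in>N i - {i}. E (\<lambda>\<omega>. of_bool (X i \<omega> \<and> X j \<omega>))))"
      using 1 2 by (simp add: algebra_simps)
  qed
  thus ?thesis unfolding W_def C_def E_def by (simp only: sum_distrib_left)
qed


section \<open>Functions of disjoint sets of coordinates\<close>

lemma expectation_Pi_pmf_restrict:
  fixes h :: "('a \<Rightarrow> 'b) \<Rightarrow> real"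
  assumes "finite S" "B \<subseteq> S" and dep: "\<And>x y. (\<And>b. b \<in> B \<Longrightarrow> x b = y b) \<Longrightarrow> h x = h y"
  shows "measure_pmf.expectation (Pi_pmf S d p) h = measure_pmf.expectation (Pi_pmf B d p) h"
proof -
  have "h (\<lambda>x. if x \<in> B then \<omega> x else d) = h \<omega>" for \<omega> by (rule dep) simp
  thus ?thesis unfolding Pi_pmf_subset[OF assms(1,2), of d p] by simp
qed

lemma expectation_pair_pmf_mult:
  fixes f :: "'a \<Rightarrow> real" and g :: "'b \<Rightarrow> real"
  assumes "finite (set_pmf p)" "finite (set_pmf q)"
  shows "measure_pmf.expectation (pair_pmf p q) (\<lambda>(x, y). f x * g y)
    = measure_pmf.expectation p f * measure_pmf.expectation q g"
proof -
  have "measure_pmf.expectation (pair_pmf p q) (\<lambda>(x, y). f x * g y)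
    = (\<Sum>z\<in>set_pmf p \<times> set_pmf q. (case z of (x, y) \<Rightarrow> f x * g y) * pmf (pair_pmf p q) z)"
    using assms by (intro integral_measure_pmf_real) auto
  also have "\<dots> = (\<Sum>x\<in>set_pmf p. f x * pmf p x) * (\<Sum>y\<in>set_pmf q. g y * pmf q y)"
    unfolding sum_product sum.cartesian_product by (intro sum.cong refl) (clarsimp simp: pmf_pair)
  also have "\<dots> = measure_pmf.expectation p f * measure_pmf.expectation q g"
    using assms by (simp add: integral_measure_pmf_real[of "set_pmf p"] integral_measure_pmf_real[of "set_pmf q"])
  finally show ?thesis .
qed

lemma finite_set_Pi_pmf:
  assumes "finite S" "\<And>x. x \<in> S \<Longrightarrow> finite (set_pmf (p x))"
  shows "finite (set_pmf (Pi_pmf S d p))"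
  using assms by (simp add: set_Pi_pmf finite_PiE_dflt)

text \<open>
  Independence in the form in which it is used: two functions of disjoint blocks of coordinates are
  uncorrelated. Finite supports spare all integrability conditions.
\<close>

lemma expectation_Pi_pmf_indep:
  fixes f h :: "('a \<Rightarrow> 'b) \<Rightarrow> real"
  assumes "finite S" "A \<subseteq> S" "B \<subseteq> S" "A \<inter> B = {}"
    and supp: "\<And>x. x \<in> S \<Longrightarrow> finite (set_pmf (p x))"
    and f: "\<And>x y. (\<And>a. a \<in> A \<Longrightarrow> x a = y a) \<Longrightarrow> f x = f y"
    and h: "\<And>x y. (\<And>b. b \<in> B \<Longrightarrow> x b = y b) \<Longrightarrow> h x = h y"
  shows "measure_pmf.expectation (Pi_pmf S d p) (\<lambda>\<omega>. f \<omega> * h \<omega>)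
    = measure_pmf.expectation (Pi_pmf S d p) f * measure_pmf.expectation (Pi_pmf S d p) h"
proof -
  have fin: "finite A" "finite B" using assms finite_subset by blast+
  have "measure_pmf.expectation (Pi_pmf S d p) (\<lambda>\<omega>. f \<omega> * h \<omega>)
      = measure_pmf.expectation (Pi_pmf (A \<union> B) d p) (\<lambda>\<omega>. f \<omega> * h \<omega>)"
  proof (rule expectation_Pi_pmf_restrict)
    fix x y :: "'a \<Rightarrow> 'b" assume "\<And>b. b \<in> A \<union> B \<Longrightarrow> x b = y b"
    thus "f x * h x = f y * h y" using f[of x y] h[of x y] by auto
  qed (use assms in auto)
  also have "\<dots> = measure_pmf.expectation (pair_pmf (Pi_pmf A d p) (Pi_pmf B d p))
      (\<lambda>(x, y). f x * h y)"
  proof -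
    have "f (\<lambda>a. if a \<in> A then x a else y a) = f x" for x y by (rule f) simp
    moreover have "h (\<lambda>a. if a \<in> A then x a else y a) = h y" for x y
      using \<open>A \<inter> B = {}\<close> by (intro h) auto
    ultimately show ?thesis
      by (subst Pi_pmf_union[OF fin \<open>A \<inter> B = {}\<close>]) (simp add: case_prod_unfold)
  qed
  also have "\<dots> = measure_pmf.expectation (Pi_pmf A d p) f * measure_pmf.expectation (Pi_pmf B d p) h"
    using assms fin by (intro expectation_pair_pmf_mult finite_set_Pi_pmf) auto
  also have "\<dots> = measure_pmf.expectation (Pi_pmf S d p) f * measure_pmf.expectation (Pi_pmf S d p) h"
    using expectation_Pi_pmf_restrict[where h = f and d = d and p = p, OF assms(1,2) f]
      expectation_Pi_pmf_restrict[where h = h and d = d and p = p, OF assms(1,3) h]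
    by simp
  finally show ?thesis .
qed

lemma expectation_bind_pmf_finite:
  fixes h :: "'b \<Rightarrow> real"
  assumes "finite (set_pmf p)" "\<And>x. x \<in> set_pmf p \<Longrightarrow> finite (set_pmf (q x))"
  shows "measure_pmf.expectation (bind_pmf p q) h
    = measure_pmf.expectation p (\<lambda>x. measure_pmf.expectation (q x) h)"
  using assms
  by (simp add: pmf_expectation_bind[of "set_pmf p"] integral_measure_pmf[of "set_pmf p" p])

section \<open>Edge probabilities in the stochastic block model\<close>

definition sbm_graph :: "nat \<Rightarrow> (nat \<times> nat \<Rightarrow> bool) \<Rightarrow> nat graph" where
  "sbm_graph n Y = Graph {1..n} {{i, j} | i j. (i, j) \<in> vertex_pairs n \<and> Y (i, j)}"

definition edge_law :: "nat \<Rightarrow> (nat \<Rightarrow> nat \<Rightarrow> real) \<Rightarrow> (nat \<Rightarrow> nat) \<Rightarrow> (nat \<times> nat \<Rightarrow> bool) pmf" where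
  "edge_law n \<pi> c = Pi_pmf (vertex_pairs n) False (\<lambda>(i, j). bernoulli_pmf (\<pi> (c i) (c j)))"

text \<open>
  Edges are unordered while the model samples \<open>Y (i, j)\<close> for \<open>i < j\<close>; for an edge \<open>e = {i, j}\<close> the
  pair is recovered as \<open>(Min e, Max e)\<close>.
\<close>

definition edge_prob :: "(nat \<Rightarrow> nat \<Rightarrow> real) \<Rightarrow> (nat \<Rightarrow> nat) \<Rightarrow> nat set \<Rightarrow> real" where
  "edge_prob \<pi> c e = \<pi> (c (Min e)) (c (Max e))"

lemma finite_vertex_pairs [simp]: "finite (vertex_pairs n)"
  by (rule finite_subset[of _ "{1..n} \<times> {1..n}"]) (auto simp: vertex_pairs_def)

lemma sbm_graph_has_edge:
  assumes "(i, j) \<in> vertex_pairs n"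
  shows "{i, j} \<in> edges (sbm_graph n Y) \<longleftrightarrow> Y (i, j)"
  using assms by (auto simp: sbm_graph_def vertex_pairs_def doubleton_eq_iff)

lemma bij_betw_pairs_nsets:
  "bij_betw (\<lambda>(i, j). {i, j}) {(i, j). (i, j) \<in> vertex_pairs n \<and> {i, j} \<in> F}
     (F \<inter> nsets {1..n} 2)"
proof (rule bij_betwI')
  fix e assume e: "e \<in> F \<inter> nsets {1..n} 2"
  then obtain i j where "e = {i, j}" "i < j" "i \<in> {1..n}" "j \<in> {1..n}"
    by (auto simp: ordered_nsets_2_eq)
  thus "\<exists>z\<in>{(i, j). (i, j) \<in> vertex_pairs n \<and> {i, j} \<in> F}. e = (case z of (i, j) \<Rightarrow> {i, j})"
    using e by (intro bexI[of _ "(i, j)"]) (auto simp: vertex_pairs_def)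
next
  fix z assume "z \<in> {(i, j). (i, j) \<in> vertex_pairs n \<and> {i, j} \<in> F}"
  thus "(case z of (i, j) \<Rightarrow> {i, j}) \<in> F \<inter> nsets {1..n} 2"
    by (auto simp: vertex_pairs_def)
next
  fix z z' assume "z \<in> {(i, j). (i, j) \<in> vertex_pairs n \<and> {i, j} \<in> F}"
    "z' \<in> {(i, j). (i, j) \<in> vertex_pairs n \<and> {i, j} \<in> F}"
  hence "fst z < snd z" "fst z' < snd z'" by (auto simp: vertex_pairs_def)
  thus "(case z of (i, j) \<Rightarrow> {i, j}) = (case z' of (i, j) \<Rightarrow> {i, j}) \<longleftrightarrow> z = z'"
    by (cases z, cases z') (fastforce simp: doubleton_eq_iff)
qed

lemma prod_pairs_eq_prod_edges:
  assumes "F \<subseteq> nsets {1..n} 2"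
  shows "(\<Prod>(i, j)\<in>{(i, j). (i, j) \<in> vertex_pairs n \<and> {i, j} \<in> F}. \<pi> (c i) (c j))
    = (\<Prod>e\<in>F. edge_prob \<pi> c e)"
proof -
  have "(\<Prod>(i, j)\<in>{(i, j). (i, j) \<in> vertex_pairs n \<and> {i, j} \<in> F}. \<pi> (c i) (c j))
    = (\<Prod>z\<in>{(i, j). (i, j) \<in> vertex_pairs n \<and> {i, j} \<in> F}. edge_prob \<pi> c (case z of (i, j) \<Rightarrow> {i, j}))"
    by (rule prod.cong) (auto simp: vertex_pairs_def edge_prob_def min_def max_def)
  also have "\<dots> = (\<Prod>e\<in>F \<inter> nsets {1..n} 2. edge_prob \<pi> c e)"
    by (rule prod.reindex_bij_betw[OF bij_betw_pairs_nsets])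
  finally show ?thesis using assms by (simp add: Int_absorb2)
qed

lemma finite_set_edge_law: "finite (set_pmf (edge_law n \<pi> c))"
  unfolding edge_law_def
  by (rule finite_set_Pi_pmf) (auto intro!: finite_subset[OF subset_UNIV])

locale stochastic_block_model =
  fixes n Q :: nat and f :: "nat \<Rightarrow> real" and \<pi> :: "nat \<Rightarrow> nat \<Rightarrow> real"
  assumes Q_pos: "Q \<ge> 1"
    and f_nonneg: "\<And>a. a \<in> {1..Q} \<Longrightarrow> f a \<ge> 0"
    and f_sum: "(\<Sum>a = 1..Q. f a) = 1"
    and \<pi>_sym: "\<And>a b. a \<in> {1..Q} \<Longrightarrow> b \<in> {1..Q} \<Longrightarrow> \<pi> a b = \<pi> b a"
    and \<pi>_prob: "\<And>a b. a \<in> {1..Q} \<Longrightarrow> b \<in> {1..Q} \<Longrightarrow> 0 \<le> \<pi> a b \<and> \<pi> a b \<le> 1"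
begin

definition class_law :: "nat set \<Rightarrow> (nat \<Rightarrow> nat) pmf" where
  "class_law A = Pi_pmf A 0 (\<lambda>_. class_pmf Q f)"

abbreviation expect :: "(nat graph \<Rightarrow> real) \<Rightarrow> real" where
  "expect \<equiv> measure_pmf.expectation (SBM n Q \<pi> f)"

definition edges_prob :: "nat set set \<Rightarrow> real" where
  "edges_prob F = expect (\<lambda>H. of_bool (F \<subseteq> edges H))"

lemma set_class_pmf: "set_pmf (class_pmf Q f) \<subseteq> {1..Q}"
  using pmf_class_pmf[of Q f] f_nonneg f_sum by (auto simp: set_pmf_eq split: if_splits)

lemma finite_set_class_law: "finite A \<Longrightarrow> finite (set_pmf (class_law A))"
  unfolding class_law_def using set_class_pmf by (intro finite_set_Pi_pmf) (auto intro: finite_subset)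

lemma class_law_range:
  assumes "c \<in> set_pmf (class_law A)" "finite A" "i \<in> A"
  shows "c i \<in> {1..Q}"
  using assms set_class_pmf by (auto simp: class_law_def set_Pi_pmf PiE_dflt_def)

lemma SBM_eq: "SBM n Q \<pi> f = bind_pmf (class_law {1..n}) (\<lambda>c. map_pmf (sbm_graph n) (edge_law n \<pi> c))"
  by (simp add: SBM_def class_law_def edge_law_def sbm_graph_def[abs_def] map_pmf_def)

lemma finite_set_SBM: "finite (set_pmf (SBM n Q \<pi> f))"
  unfolding SBM_eq by (auto simp: finite_set_edge_law finite_set_class_law)

lemma verts_SBM: "H \<in> set_pmf (SBM n Q \<pi> f) \<Longrightarrow> verts H = {1..n}"
  unfolding SBM_eq by (auto simp: sbm_graph_def)

lemma expect_SBM: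
  "expect h = measure_pmf.expectation (class_law {1..n})
     (\<lambda>c. measure_pmf.expectation (edge_law n \<pi> c) (\<lambda>Y. h (sbm_graph n Y)))"
  unfolding SBM_eq
  by (subst expectation_bind_pmf_finite) (auto simp: finite_set_class_law finite_set_edge_law)

lemma finite_probs: "finite {\<pi> a b | a b. 1 \<le> a \<and> a \<le> b \<and> b \<le> Q}"
  by (rule finite_subset[of _ "(\<lambda>(a, b). \<pi> a b) ` ({1..Q} \<times> {1..Q})"]) auto

lemma edge_prob_bounds:
  assumes "F \<subseteq> nsets A 2" "\<And>i. i \<in> A \<Longrightarrow> c i \<in> {1..Q}" "e \<in> F"
  shows "0 \<le> edge_prob \<pi> c e" "edge_prob \<pi> c e \<le> max_prob Q \<pi>"
proof -
  have "finite e" "e \<noteq> {}" "e \<subseteq> A" using assms(1,3) by (auto simp: nsets_def)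
  hence mem: "c (Min e) \<in> {1..Q}" "c (Max e) \<in> {1..Q}"
    using assms(2) Min_in[of e] Max_in[of e] by blast+
  thus "0 \<le> edge_prob \<pi> c e"
    using \<pi>_prob unfolding edge_prob_def by blast+
  note finite_probs
  moreover have "edge_prob \<pi> c e \<in> {\<pi> a b | a b. 1 \<le> a \<and> a \<le> b \<and> b \<le> Q}"
  proof (cases "c (Min e) \<le> c (Max e)")
    case True
    thus ?thesis using mem unfolding edge_prob_def by auto
  next
    case False
    hence "c (Max e) \<le> c (Min e)" by simp
    thus ?thesis using mem unfolding edge_prob_def \<pi>_sym[OF mem] by auto
  qed
  ultimately show "edge_prob \<pi> c e \<le> max_prob Q \<pi>" unfolding max_prob_def by (rule Max_ge)
qed

lemma max_prob_bounds: "0 \<le> max_prob Q \<pi>" "max_prob Q \<pi> \<le> 1"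
proof -
  note fin = finite_probs
  have mem: "\<pi> 1 1 \<in> {\<pi> a b | a b. 1 \<le> a \<and> a \<le> b \<and> b \<le> Q}" using Q_pos by auto
  show "0 \<le> max_prob Q \<pi>" unfolding max_prob_def
    using Max_ge[OF fin mem] \<pi>_prob[of 1 1] Q_pos by force
  show "max_prob Q \<pi> \<le> 1" unfolding max_prob_def
    using \<pi>_prob fin mem by (subst Max_le_iff) auto
qed

lemma edges_prob_given_classes:
  assumes F: "F \<subseteq> nsets {1..n} 2" and c: "\<And>i. i \<in> {1..n} \<Longrightarrow> c i \<in> {1..Q}"
  shows "measure_pmf.expectation (edge_law n \<pi> c) (\<lambda>Y. of_bool (F \<subseteq> edges (sbm_graph n Y)))
    = (\<Prod>e\<in>F. edge_prob \<pi> c e)"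
proof -
  let ?P = "{(i, j). (i, j) \<in> vertex_pairs n \<and> {i, j} \<in> F}"
  have P: "?P \<subseteq> vertex_pairs n" by auto
  hence finP: "finite ?P" using finite_subset finite_vertex_pairs by blast
  have img: "(\<lambda>(i, j). {i, j}) ` ?P = F"
    using bij_betw_imp_surj_on[OF bij_betw_pairs_nsets[of n F]] F by auto
  have present: "F \<subseteq> edges (sbm_graph n Y) \<longleftrightarrow> (\<forall>z\<in>?P. Y z)" for Y
    using sbm_graph_has_edge[of _ _ n Y] by (subst img[symmetric]) auto
  have prod_of_bool: "of_bool (\<forall>z\<in>R. Y z) = (\<Prod>z\<in>R. of_bool (Y z) :: real)"
    if "finite R" for R and Y :: "nat \<times> nat \<Rightarrow> bool"
    using that by (induction R rule: finite_induct) (simp_all add: of_bool_conj)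
  have "of_bool (F \<subseteq> edges (sbm_graph n Y)) = (\<Prod>z\<in>?P. of_bool (Y z) :: real)" for Y
    unfolding present by (rule prod_of_bool[OF finP])
  hence "measure_pmf.expectation (edge_law n \<pi> c) (\<lambda>Y. of_bool (F \<subseteq> edges (sbm_graph n Y)))
    = measure_pmf.expectation (edge_law n \<pi> c) (\<lambda>Y. \<Prod>z\<in>?P. of_bool (Y z) :: real)"
    by simp
  also have "\<dots> = measure_pmf.expectation
      (Pi_pmf ?P False (\<lambda>(i, j). bernoulli_pmf (\<pi> (c i) (c j)))) (\<lambda>Y. \<Prod>z\<in>?P. of_bool (Y z))"
    unfolding edge_law_def
    by (rule expectation_Pi_pmf_restrict) (use P in \<open>auto intro!: prod.cong\<close>)
  also have "\<dots> = (\<Prod>z\<in>?P. measure_pmf.expectation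
      (case z of (i, j) \<Rightarrow> bernoulli_pmf (\<pi> (c i) (c j))) of_bool)"
  proof (rule expectation_prod_Pi_pmf[OF finP])
    show "integrable (measure_pmf (case z of (i, j) \<Rightarrow> bernoulli_pmf (\<pi> (c i) (c j))))
        (of_bool :: bool \<Rightarrow> real)" for z
      by (rule integrable_measure_pmf_finite) (rule finite_subset[OF subset_UNIV], simp)
  qed simp
  also have "\<dots> = (\<Prod>(i, j)\<in>?P. \<pi> (c i) (c j))"
  proof (rule prod.cong[OF refl], clarify)
    fix i j assume "(i, j) \<in> vertex_pairs n"
    hence "0 \<le> \<pi> (c i) (c j) \<and> \<pi> (c i) (c j) \<le> 1"
      using c \<pi>_prob by (auto simp: vertex_pairs_def)
    thus "measure_pmf.expectation (bernoulli_pmf (\<pi> (c i) (c j))) of_bool = \<pi> (c i) (c j)"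
      by simp
  qed
  also have "\<dots> = (\<Prod>e\<in>F. edge_prob \<pi> c e)" by (rule prod_pairs_eq_prod_edges[OF F])
  finally show ?thesis .
qed

lemma edges_prob_eq:
  assumes "F \<subseteq> nsets {1..n} 2"
  shows "edges_prob F
    = measure_pmf.expectation (class_law {1..n}) (\<lambda>c. \<Prod>e\<in>F. edge_prob \<pi> c e)"
  unfolding edges_prob_def expect_SBM
  by (intro integral_cong_AE)
    (auto simp: AE_measure_pmf_iff intro!: edges_prob_given_classes[OF assms] dest: class_law_range)

text \<open>
  Given the classes the edges are independent, so demanding the edges of \<open>F' - F\<close> in addition multiplies
  the conditional probability by one factor at most \<open>max_prob\<close> for each of them.
\<close>

lemma edges_prob_Un_le:
  assumes F: "F \<subseteq> nsets {1..n} 2" and F': "F' \<subseteq> nsets {1..n} 2"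
  shows "edges_prob (F \<union> F') \<le> edges_prob F * max_prob Q \<pi> ^ card (F' - F)"
proof -
  have fin: "finite F" "finite F'"
    using F F' finite_imp_finite_nsets[of "{1..n}" 2] finite_subset by blast+
  have "edges_prob (F \<union> F')
      = measure_pmf.expectation (class_law {1..n}) (\<lambda>c. \<Prod>e\<in>F \<union> F'. edge_prob \<pi> c e)"
    using F F' by (intro edges_prob_eq) auto
  also have "\<dots> \<le> measure_pmf.expectation (class_law {1..n})
      (\<lambda>c. (\<Prod>e\<in>F. edge_prob \<pi> c e) * max_prob Q \<pi> ^ card (F' - F))"
  proof (rule integral_mono_AE)
    show "AE c in class_law {1..n}. (\<Prod>e\<in>F \<union> F'. edge_prob \<pi> c e)
        \<le> (\<Prod>e\<in>F. edge_prob \<pi> c e) * max_prob Q \<pi> ^ card (F' - F)"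
    proof (subst AE_measure_pmf_iff, rule ballI)
      fix c assume "c \<in> set_pmf (class_law {1..n})"
      hence c: "c i \<in> {1..Q}" if "i \<in> {1..n}" for i using class_law_range that by blast
      have "(\<Prod>e\<in>F \<union> F'. edge_prob \<pi> c e) = (\<Prod>e\<in>F. edge_prob \<pi> c e) * (\<Prod>e\<in>F' - F. edge_prob \<pi> c e)"
        using fin by (subst prod.union_disjoint[symmetric]) auto
      also have "\<dots> \<le> (\<Prod>e\<in>F. edge_prob \<pi> c e) * (\<Prod>e\<in>F' - F. max_prob Q \<pi>)"
        using edge_prob_bounds[OF F c] edge_prob_bounds[OF F' c]
        by (intro mult_left_mono prod_mono prod_nonneg) auto
      finally show "(\<Prod>e\<in>F \<union> F'. edge_prob \<pi> c e)
        \<le> (\<Prod>e\<in>F. edge_prob \<pi> c e) * max_prob Q \<pi> ^ card (F' - F)" by simp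
    qed
  qed (intro integrable_measure_pmf_finite finite_set_class_law; simp)+
  also have "\<dots> = edges_prob F * max_prob Q \<pi> ^ card (F' - F)"
    by (simp add: edges_prob_eq[OF F])
  finally show ?thesis .
qed

lemma edges_prob_nonneg: "0 \<le> edges_prob F"
  unfolding edges_prob_def by (intro integral_nonneg_AE) auto

lemma edges_prob_le:
  assumes "F \<subseteq> nsets {1..n} 2"
  shows "edges_prob F \<le> max_prob Q \<pi> ^ card F"
  using edges_prob_Un_le[of "{}" F] assms by (simp add: edges_prob_def)

text \<open>
  Functions of the subgraphs induced on disjoint vertex sets are independent. The argument uses the
  product structure twice: given the classes \<open>c\<close>, the two functions depend on disjoint sets of edge
  variables; and each conditional expectation depends only on the classes of the respective vertices,
  since the law of an edge variable involves only the classes of its two ends.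
\<close>

lemma expect_indep:
  assumes AB: "A \<subseteq> {1..n}" "B \<subseteq> {1..n}" "A \<inter> B = {}"
    and g: "\<And>H H'. edges H \<inter> nsets A 2 = edges H' \<inter> nsets A 2 \<Longrightarrow> g H = g H'"
    and h: "\<And>H H'. edges H \<inter> nsets B 2 = edges H' \<inter> nsets B 2 \<Longrightarrow> h H = h H'"
  shows "expect (\<lambda>H. g H * h H) = expect g * expect h"
proof -
  let ?EY = "\<lambda>c. measure_pmf.expectation (edge_law n \<pi> c)"
  let ?Ec = "measure_pmf.expectation (class_law {1..n})"
  define P where "P = (\<lambda>S. vertex_pairs n \<inter> S \<times> S)"
  have local: "edges (sbm_graph n Y) \<inter> nsets S 2 = edges (sbm_graph n Y') \<inter> nsets S 2"
    if eq: "\<And>z. z \<in> P S \<Longrightarrow> Y z = Y' z" for S Y Y'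
  proof -
    have "edges (sbm_graph n Y) \<inter> nsets S 2 = {{i, j} | i j. (i, j) \<in> P S \<and> Y (i, j)}" for Y
      by (auto simp: sbm_graph_def P_def nsets_2_eq vertex_pairs_def doubleton_eq_iff) blast+
    moreover have "{{i, j} | i j. (i, j) \<in> P S \<and> Y (i, j)} = {{i, j} | i j. (i, j) \<in> P S \<and> Y' (i, j)}"
      using eq by blast
    ultimately show ?thesis by simp
  qed
  \<comment> \<open>The conditional expectation of a function of the graph on \<open>S\<close> is a function of the classes on \<open>S\<close>.\<close>
  have cond: "?EY c (\<lambda>Y. k (sbm_graph n Y)) = ?EY c' (\<lambda>Y. k (sbm_graph n Y))"
    if k: "\<And>H H'. edges H \<inter> nsets S 2 = edges H' \<inter> nsets S 2 \<Longrightarrow> k H = k H'"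
      and c: "\<And>i. i \<in> S \<Longrightarrow> c i = c' i" for k :: "nat graph \<Rightarrow> real" and S c c'
  proof -
    have "?EY c (\<lambda>Y. k (sbm_graph n Y)) = measure_pmf.expectation
      (Pi_pmf (P S) False (\<lambda>(i, j). bernoulli_pmf (\<pi> (c i) (c j)))) (\<lambda>Y. k (sbm_graph n Y))" for c
      unfolding edge_law_def
      by (rule expectation_Pi_pmf_restrict) (auto simp: P_def intro!: k local)
    moreover have "Pi_pmf (P S) False (\<lambda>(i, j). bernoulli_pmf (\<pi> (c i) (c j)))
        = Pi_pmf (P S) False (\<lambda>(i, j). bernoulli_pmf (\<pi> (c' i) (c' j)))"
      by (rule Pi_pmf_cong) (auto simp: P_def c)
    ultimately show ?thesis by simp
  qed
  have "expect (\<lambda>H. g H * h H)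
      = ?Ec (\<lambda>c. ?EY c (\<lambda>Y. g (sbm_graph n Y)) * ?EY c (\<lambda>Y. h (sbm_graph n Y)))"
    unfolding expect_SBM edge_law_def
    by (intro Bochner_Integration.integral_cong refl expectation_Pi_pmf_indep[where A = "P A" and B = "P B"])
      (use AB in \<open>auto simp: P_def intro!: g h local finite_subset[OF subset_UNIV]\<close>)
  also have "\<dots> = ?Ec (\<lambda>c. ?EY c (\<lambda>Y. g (sbm_graph n Y))) * ?Ec (\<lambda>c. ?EY c (\<lambda>Y. h (sbm_graph n Y)))"
    unfolding class_law_def
    by (rule expectation_Pi_pmf_indep[where A = A and B = B])
      (use AB set_class_pmf in \<open>auto intro: finite_subset intro!: cond[of A g] cond[of B h] g h\<close>)
  finally show ?thesis by (simp only: expect_SBM)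
qed

text \<open>
  The defining sum of \<open>mu\<close> ranges over class assignments that are \<open>undefined\<close> off the vertex set, whereas
  \<open>class_law\<close> fills in 0; restriction is a bijection between the two kinds of functions.
\<close>

lemma mu_eq_expectation:
  assumes "simple_graph G" "verts G = {1..num_verts G}"
  shows "mu Q \<pi> f G = measure_pmf.expectation (class_law (verts G))
     (\<lambda>c. \<Prod>e\<in>edges G. edge_prob \<pi> c e)"
proof -
  let ?V = "{1..num_verts G}"
  let ?D = "PiE_dflt ?V 0 (\<lambda>_. {1..Q})"
  have E: "edges G \<subseteq> nsets ?V 2" using assms by (auto simp: simple_graph_def)
  have pmf: "pmf (class_pmf Q f) a = f a" if "a \<in> {1..Q}" for a
    using pmf_class_pmf[of Q f a] f_nonneg f_sum that by auto
  have "measure_pmf.expectation (class_law ?V) (\<lambda>c. \<Prod>e\<in>edges G. edge_prob \<pi> c e)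
      = (\<Sum>c\<in>?D. (\<Prod>e\<in>edges G. edge_prob \<pi> c e) * pmf (class_law ?V) c)"
  proof (rule integral_measure_pmf_real)
    show "c \<in> ?D" if "c \<in> set_pmf (class_law ?V)" for c
      using that set_class_pmf unfolding class_law_def
      by (subst (asm) set_Pi_pmf) (auto simp: PiE_dflt_def)
  qed (auto intro: finite_PiE_dflt)
  also have "\<dots> = (\<Sum>c\<in>?D. (\<Prod>u\<in>?V. f (c u)) * (\<Prod>e\<in>edges G. edge_prob \<pi> c e))"
  proof (rule sum.cong[OF refl])
    fix c assume c: "c \<in> ?D"
    have "pmf (class_law ?V) c = (\<Prod>u\<in>?V. pmf (class_pmf Q f) (c u))"
      unfolding class_law_def using c by (intro pmf_Pi') (auto simp: PiE_dflt_def)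
    also have "\<dots> = (\<Prod>u\<in>?V. f (c u))"
      using c by (intro prod.cong refl pmf) (auto simp: PiE_dflt_def)
    finally show "(\<Prod>e\<in>edges G. edge_prob \<pi> c e) * pmf (class_law ?V) c
      = (\<Prod>u\<in>?V. f (c u)) * (\<Prod>e\<in>edges G. edge_prob \<pi> c e)" by simp
  qed
  also have "\<dots> = (\<Sum>c\<in>(\<lambda>c. restrict c ?V) ` ?D. (\<Prod>u\<in>?V. f (c u)) * (\<Prod>e\<in>edges G. edge_prob \<pi> c e))"
  proof (subst sum.reindex)
    show "inj_on (\<lambda>c. restrict c ?V) ?D"
      by (rule inj_onI) (auto simp: PiE_dflt_def fun_eq_iff restrict_def split: if_splits, metis)
    show "(\<Sum>c\<in>?D. (\<Prod>u\<in>?V. f (c u)) * (\<Prod>e\<in>edges G. edge_prob \<pi> c e))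
      = sum ((\<lambda>c. (\<Prod>u\<in>?V. f (c u)) * (\<Prod>e\<in>edges G. edge_prob \<pi> c e)) \<circ> (\<lambda>c. restrict c ?V)) ?D"
      unfolding prod_pairs_eq_prod_edges[OF E, symmetric] o_def
      by (intro sum.cong refl arg_cong2[of _ _ _ _ "(*)"] prod.cong) (auto simp: vertex_pairs_def)
  qed
  also have "\<dots> = mu Q \<pi> f G"
    unfolding mu_def prod_pairs_eq_prod_edges[OF E] restrict_PiE_dflt ..
  finally show ?thesis using assms(2) by simp
qed

text \<open>
  The classes are independent and identically distributed and \<open>\<pi>\<close> is symmetric, so the probability that
  a copy is present does not depend on where the copy lies nor on how its vertices are ordered.
\<close>

lemma edges_prob_relabel:
  assumes G: "simple_graph G" "verts G = {1..num_verts G}"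
    and \<phi>: "inj_on \<phi> (verts G)" "\<phi> ` verts G \<subseteq> {1..n}"
  shows "edges_prob ((\<lambda>e. \<phi> ` e) ` edges G) = mu Q \<pi> f G"
proof -
  let ?V = "verts G" and ?A = "\<phi> ` verts G"
  have finV: "finite ?V" and E: "edges G \<subseteq> nsets ?V 2"
    using G(1) by (auto simp: simple_graph_def)
  have sub: "e \<subseteq> ?V" if "e \<in> edges G" for e using E that by (auto simp: nsets_def)
  have F: "(\<lambda>e. \<phi> ` e) ` edges G \<subseteq> nsets ?A 2"
  proof (rule image_subsetI)
    fix e assume "e \<in> edges G"
    hence "e \<subseteq> ?V" "finite e" "card e = 2" using E by (auto simp: nsets_def)
    moreover have "card (\<phi> ` e) = card e"
      using \<phi>(1) \<open>e \<subseteq> ?V\<close> by (meson card_image inj_on_subset)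
    ultimately show "\<phi> ` e \<in> nsets ?A 2" by (auto simp: nsets_def)
  qed
  have inj: "inj_on (\<lambda>e. \<phi> ` e) (edges G)"
    using inj_on_subset[OF inj_on_image_Pow[OF \<phi>(1)]] sub by auto
  have Fn: "(\<lambda>e. \<phi> ` e) ` edges G \<subseteq> nsets {1..n} 2"
    using F nsets_mono[OF \<phi>(2)] by blast
  have "edges_prob ((\<lambda>e. \<phi> ` e) ` edges G)
      = measure_pmf.expectation (class_law {1..n}) (\<lambda>c. \<Prod>e\<in>edges G. edge_prob \<pi> c (\<phi> ` e))"
    by (simp add: edges_prob_eq[OF Fn] prod.reindex[OF inj] o_def)
  also have "\<dots> = measure_pmf.expectation (class_law ?A) (\<lambda>c. \<Prod>e\<in>edges G. edge_prob \<pi> c (\<phi> ` e))"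
    unfolding class_law_def
  proof (rule expectation_Pi_pmf_restrict)
    fix c c' :: "nat \<Rightarrow> nat" assume eq: "\<And>b. b \<in> ?A \<Longrightarrow> c b = c' b"
    show "(\<Prod>e\<in>edges G. edge_prob \<pi> c (\<phi> ` e)) = (\<Prod>e\<in>edges G. edge_prob \<pi> c' (\<phi> ` e))"
    proof (rule prod.cong[OF refl])
      fix e assume "e \<in> edges G"
      hence "\<phi> ` e \<in> nsets ?A 2" using F by auto
      hence "finite (\<phi> ` e)" "\<phi> ` e \<noteq> {}" "\<phi> ` e \<subseteq> ?A" by (auto simp: nsets_def)
      hence "Min (\<phi> ` e) \<in> ?A" "Max (\<phi> ` e) \<in> ?A"
        by (meson Min_in subsetD, meson Max_in subsetD)
      thus "edge_prob \<pi> c (\<phi> ` e) = edge_prob \<pi> c' (\<phi> ` e)"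
        by (simp only: edge_prob_def eq)
    qed
  qed (use \<phi>(2) in auto)
  also have "\<dots> = measure_pmf.expectation (class_law ?V) (\<lambda>c. \<Prod>e\<in>edges G. edge_prob \<pi> c e)"
  proof -
    \<comment> \<open>The vertex 0 lies outside \<open>{1..n}\<close>: sending all other points there makes \<open>c \<circ> \<psi>\<close> take the
      default class off the vertices of \<open>G\<close>.\<close>
    define \<psi> where "\<psi> = (\<lambda>x. if x \<in> ?V then \<phi> x else 0)"
    have "class_law ?V = map_pmf (\<lambda>c. c \<circ> \<psi>) (class_law ?A)"
      unfolding class_law_def
    proof (rule Pi_pmf_bij_betw[OF finV])
      show "bij_betw \<psi> ?V ?A"
        using \<phi>(1) by (auto simp: \<psi>_def bij_betw_def inj_on_def)
      show "\<psi> x \<notin> ?A" if "x \<notin> ?V" for x using that \<phi>(2) by (force simp: \<psi>_def)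
    qed
    hence "measure_pmf.expectation (class_law ?V) (\<lambda>c. \<Prod>e\<in>edges G. edge_prob \<pi> c e)
      = measure_pmf.expectation (class_law ?A) (\<lambda>c. \<Prod>e\<in>edges G. edge_prob \<pi> (c \<circ> \<psi>) e)"
      by simp
    also have "\<dots> = measure_pmf.expectation (class_law ?A) (\<lambda>c. \<Prod>e\<in>edges G. edge_prob \<pi> c (\<phi> ` e))"
    proof (intro integral_cong_AE)
      show "AE c in class_law ?A. (\<Prod>e\<in>edges G. edge_prob \<pi> (c \<circ> \<psi>) e)
          = (\<Prod>e\<in>edges G. edge_prob \<pi> c (\<phi> ` e))"
      proof (subst AE_measure_pmf_iff, rule ballI, rule prod.cong[OF refl])
        fix c e assume c: "c \<in> set_pmf (class_law ?A)" and e: "e \<in> edges G"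
        obtain i j where ij: "e = {i, j}" "i < j" "i \<in> ?V" "j \<in> ?V"
          using E e by (auto simp: ordered_nsets_2_eq)
        have "c (\<phi> i) \<in> {1..Q}" "c (\<phi> j) \<in> {1..Q}"
          using class_law_range[OF c] finV ij by auto
        from \<pi>_sym[OF this] have "edge_prob \<pi> c {\<phi> i, \<phi> j} = \<pi> (c (\<phi> i)) (c (\<phi> j))"
          by (cases "\<phi> i \<le> \<phi> j") (simp_all add: edge_prob_def min_def max_def)
        moreover have "edge_prob \<pi> (c \<circ> \<psi>) {i, j} = \<pi> (c (\<phi> i)) (c (\<phi> j))"
          using ij by (simp add: edge_prob_def \<psi>_def min_def max_def)
        ultimately show "edge_prob \<pi> (c \<circ> \<psi>) e = edge_prob \<pi> c (\<phi> ` e)"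
          by (simp only: ij image_insert image_empty)
      qed
    qed simp_all
    finally show ?thesis by simp
  qed
  also have "\<dots> = mu Q \<pi> f G" by (rule mu_eq_expectation[OF G, symmetric])
  finally show ?thesis .
qed

end


section \<open>Copies of a graph\<close>

definition graph_image :: "('a \<Rightarrow> 'b) \<Rightarrow> 'a graph \<Rightarrow> 'b graph" where
  "graph_image \<phi> H = Graph (\<phi> ` verts H) ((\<lambda>e. \<phi> ` e) ` edges H)"

lemma graph_image_simps [simp]:
  "verts (graph_image \<phi> H) = \<phi> ` verts H" "edges (graph_image \<phi> H) = (\<lambda>e. \<phi> ` e) ` edges H"
  by (simp_all add: graph_image_def)

lemma simple_graph_edge:
  assumes "simple_graph G" "e \<in> edges G"
  shows "e \<subseteq> verts G" "card e = 2" "finite e"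
  using assms by (auto simp: simple_graph_def nsets_def)

lemma simple_graph_finite_edges: "simple_graph G \<Longrightarrow> finite (edges G)"
  unfolding simple_graph_def using finite_imp_finite_nsets finite_subset by blast

lemma copies_on_iff:
  "K \<in> copies_on G A \<longleftrightarrow> simple_graph K \<and> verts K \<subseteq> A \<and> graph_iso K G"
  using nsets_mono[of "verts K" A 2]
  by (auto simp: copies_on_def subgraph_def complete_graph_def simple_graph_def)

lemma finite_copies_on:
  assumes "finite A"
  shows "finite (copies_on G A)"
proof (rule finite_subset)
  show "copies_on G A \<subseteq> (\<lambda>(V, E). Graph V E) ` (Pow A \<times> Pow (nsets A 2))"
  proof
    fix K assume "K \<in> copies_on G A"
    hence "verts K \<subseteq> A" "edges K \<subseteq> nsets A 2"
      by (auto simp: copies_on_def subgraph_def complete_graph_def)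
    thus "K \<in> (\<lambda>(V, E). Graph V E) ` (Pow A \<times> Pow (nsets A 2))"
      by (intro image_eqI[of _ _ "(verts K, edges K)"]) auto
  qed
qed (use assms finite_imp_finite_nsets[OF assms, of 2] in simp)

lemma inj_on_image_edges:
  assumes "simple_graph G" "inj_on \<phi> (verts G)"
  shows "inj_on (\<lambda>e. \<phi> ` e) (edges G)"
  by (rule inj_on_subset[OF inj_on_image_Pow[OF assms(2)]])
    (use simple_graph_edge[OF assms(1)] in auto)

lemma simple_graph_image:
  assumes "simple_graph G" "inj_on \<phi> (verts G)"
  shows "simple_graph (graph_image \<phi> G)"
proof -
  have "\<phi> ` e \<in> nsets (\<phi> ` verts G) 2" if e: "e \<in> edges G" for e
    using simple_graph_edge[OF assms(1) e] card_image[OF inj_on_subset[OF assms(2)], of e]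
    by (auto simp: nsets_def)
  thus ?thesis using assms(1) by (auto simp: simple_graph_def)
qed

lemma graph_iso_image:
  assumes G: "simple_graph G" and \<phi>: "inj_on \<phi> (verts G)"
  shows "graph_iso (graph_image \<phi> G) G"
  unfolding graph_iso_def
proof (intro exI conjI)
  let ?\<psi> = "inv_into (verts G) \<phi>"
  show "bij_betw ?\<psi> (verts (graph_image \<phi> G)) (verts G)"
    using \<phi> by (simp add: bij_betw_imp_surj_on bij_betw_inv_into inj_on_imp_bij_betw)
  have "?\<psi> ` \<phi> ` e = e" if "e \<in> edges G" for e
    using inv_into_image_cancel[OF \<phi>] simple_graph_edge[OF G that] by simp
  thus "(\<lambda>e. ?\<psi> ` e) ` edges (graph_image \<phi> G) = edges G"
    by (simp add: image_image)
qed

lemma graph_iso_obtain_image: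
  assumes K: "simple_graph K" and iso: "graph_iso K G"
  obtains \<phi> where "inj_on \<phi> (verts G)" "K = graph_image \<phi> G"
proof -
  obtain \<psi> where \<psi>: "bij_betw \<psi> (verts K) (verts G)" "(\<lambda>e. \<psi> ` e) ` edges K = edges G"
    using iso by (auto simp: graph_iso_def)
  let ?\<phi> = "inv_into (verts K) \<psi>"
  have bij: "bij_betw ?\<phi> (verts G) (verts K)" by (rule bij_betw_inv_into[OF \<psi>(1)])
  have "?\<phi> ` \<psi> ` e = e" if "e \<in> edges K" for e
    using inv_into_image_cancel[OF bij_betw_imp_inj_on[OF \<psi>(1)]] simple_graph_edge[OF K that] by simp
  hence "(\<lambda>e. ?\<phi> ` e) ` edges G = edges K"
    unfolding \<psi>(2)[symmetric] by (simp add: image_image)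
  hence "K = graph_image ?\<phi> G"
    using bij by (cases K) (simp add: graph_image_def bij_betw_def)
  thus thesis using that bij by (auto simp: bij_betw_def)
qed

lemma copy_sizes:
  assumes "simple_graph G" "K \<in> copies_on G A"
  shows "num_verts K = num_verts G" "num_edges K = num_edges G"
proof -
  obtain \<phi> where \<phi>: "inj_on \<phi> (verts G)" "K = graph_image \<phi> G"
    using assms(2) graph_iso_obtain_image by (metis copies_on_iff)
  show "num_verts K = num_verts G" using \<phi> by (simp add: num_verts_def card_image)
  show "num_edges K = num_edges G"
    using \<phi>(2) card_image[OF inj_on_image_edges[OF assms(1) \<phi>(1)]] by (simp add: num_edges_def)
qed

lemma verts_copy_full:
  assumes "simple_graph G" "K \<in> copies_on G A" "finite A" "card A = num_verts G"
  shows "verts K = A"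
proof (rule card_subset_eq[OF assms(3)])
  show "verts K \<subseteq> A" using assms(2) by (simp add: copies_on_iff)
  show "card (verts K) = card A"
    using copy_sizes(1)[OF assms(1,2)] assms(4) by (simp add: num_verts_def)
qed

text \<open>
  Fix one bijection \<open>\<phi>0\<close> from the vertices of \<open>G\<close> to \<open>A\<close>. The permutations \<open>\<sigma>\<close> of the vertices map onto
  the copies by sending \<open>\<sigma>\<close> to the image of \<open>G\<close> under \<open>\<phi>0 \<circ> \<sigma>\<close>, and the fibres of this map are the
  left cosets \<open>\<tau> \<circ> Aut\<close> of the automorphism group.
\<close>

lemma card_copies_on:
  assumes G: "simple_graph G" and A: "finite A" "card A = num_verts G"
  shows "real (card (copies_on G A)) = rho G"
proof -
  let ?V = "verts G" and ?E = "edges G"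
  define S where "S = {\<sigma>. \<sigma> permutes ?V}"
  define Aut where "Aut = {\<sigma>. \<sigma> permutes ?V \<and> (\<lambda>e. \<sigma> ` e) ` ?E = ?E}"
  have finV: "finite ?V" using G by (simp add: simple_graph_def)
  have finS: "finite S" unfolding S_def by (rule finite_permutations[OF finV])
  obtain \<phi>0 where \<phi>0: "bij_betw \<phi>0 ?V A"
    using finite_same_card_bij[OF finV A(1)] A(2) by (auto simp: num_verts_def)
  define T where "T = (\<lambda>\<sigma>. graph_image (\<phi>0 \<circ> \<sigma>) G)"
  have img: "T ` S = copies_on G A"
  proof (intro equalityI subsetI)
    fix K assume "K \<in> T ` S"
    then obtain \<sigma> where \<sigma>: "\<sigma> permutes ?V" "K = graph_image (\<phi>0 \<circ> \<sigma>) G"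
      by (auto simp: S_def T_def)
    have bij: "bij_betw (\<phi>0 \<circ> \<sigma>) ?V A"
      using permutes_imp_bij[OF \<sigma>(1)] \<phi>0 by (rule bij_betw_trans)
    thus "K \<in> copies_on G A"
      unfolding copies_on_iff \<sigma>(2) using simple_graph_image[OF G] graph_iso_image[OF G]
      by (auto simp: bij_betw_def)
  next
    fix K assume K: "K \<in> copies_on G A"
    then obtain \<phi> where \<phi>: "inj_on \<phi> ?V" "K = graph_image \<phi> G"
      using graph_iso_obtain_image by (metis copies_on_iff)
    have \<phi>A: "bij_betw \<phi> ?V A"
      using \<phi> verts_copy_full[OF G K A] by (simp add: bij_betw_def)
    define \<sigma> where "\<sigma> = (\<lambda>x. if x \<in> ?V then inv_into ?V \<phi>0 (\<phi> x) else x)"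
    have "bij_betw (inv_into ?V \<phi>0 \<circ> \<phi>) ?V ?V"
      by (rule bij_betw_trans[OF \<phi>A bij_betw_inv_into[OF \<phi>0]])
    hence "bij_betw \<sigma> ?V ?V"
      by (subst bij_betw_cong[of _ _ "inv_into ?V \<phi>0 \<circ> \<phi>"]) (simp_all add: \<sigma>_def)
    hence \<sigma>: "\<sigma> \<in> S" unfolding S_def by (auto intro: bij_imp_permutes simp: \<sigma>_def)
    have eq: "(\<phi>0 \<circ> \<sigma>) x = \<phi> x" if "x \<in> ?V" for x
      using that \<phi>A \<phi>0 by (auto simp: \<sigma>_def bij_betw_def intro!: f_inv_into_f)
    have "T \<sigma> = K"
      unfolding T_def \<phi>(2) graph_image_def graph.inject
    proof
      show "(\<phi>0 \<circ> \<sigma>) ` ?V = \<phi> ` ?V" by (rule image_cong[OF refl eq])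
      show "(\<lambda>e. (\<phi>0 \<circ> \<sigma>) ` e) ` ?E = (\<lambda>e. \<phi> ` e) ` ?E"
        by (intro image_cong refl eq) (use simple_graph_edge[OF G] in auto)
    qed
    thus "K \<in> T ` S" using \<sigma> by auto
  qed
  have fibre: "card {\<sigma> \<in> S. T \<sigma> = K} = card Aut" if K: "K \<in> T ` S" for K
  proof -
    obtain \<tau> where \<tau>: "\<tau> permutes ?V" "K = T \<tau>" using K unfolding S_def by blast
    have E_sub: "(\<lambda>e. \<sigma> ` e) ` ?E \<subseteq> Pow ?V" if "\<sigma> permutes ?V" for \<sigma>
      using permutes_image[OF that] simple_graph_edge(1)[OF G] by blast
    have edges_T: "edges (T \<sigma>) = (\<lambda>e. \<phi>0 ` e) ` (\<lambda>e. \<sigma> ` e) ` ?E" for \<sigma>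
      by (simp add: T_def image_image image_comp)
    have verts_T: "verts (T \<sigma>) = A" if "\<sigma> permutes ?V" for \<sigma>
      unfolding T_def graph_image_simps image_comp[symmetric] permutes_image[OF that]
      by (rule bij_betw_imp_surj_on[OF \<phi>0])
    have "{\<sigma> \<in> S. T \<sigma> = K} = (\<lambda>g. \<tau> \<circ> g) ` Aut"
    proof (intro equalityI subsetI)
      fix \<sigma> assume "\<sigma> \<in> {\<sigma> \<in> S. T \<sigma> = K}"
      hence \<sigma>: "\<sigma> permutes ?V" "T \<sigma> = T \<tau>" by (auto simp: S_def \<tau>)
      have "(\<lambda>e. \<sigma> ` e) ` ?E = (\<lambda>e. \<tau> ` e) ` ?E"
        using \<sigma>(2) edges_T inj_on_image_eq_iff[OF inj_on_image_Pow[OF bij_betw_imp_inj_on[OF \<phi>0]]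
            E_sub[OF \<sigma>(1)] E_sub[OF \<tau>(1)]] by metis
      hence "(\<lambda>e. inv \<tau> ` e) ` (\<lambda>e. \<sigma> ` e) ` ?E = (\<lambda>e. inv \<tau> ` e) ` (\<lambda>e. \<tau> ` e) ` ?E"
        by simp
      hence "(\<lambda>e. (inv \<tau> \<circ> \<sigma>) ` e) ` ?E = ?E"
        using permutes_inverses(2)[OF \<tau>(1)] by (simp add: image_image image_comp)
      hence "inv \<tau> \<circ> \<sigma> \<in> Aut"
        unfolding Aut_def using \<sigma>(1) \<tau>(1) by (auto intro: permutes_compose permutes_inv)
      moreover have "\<sigma> = \<tau> \<circ> (inv \<tau> \<circ> \<sigma>)"
        using permutes_inv_o(1)[OF \<tau>(1)] by (simp add: o_assoc)
      ultimately show "\<sigma> \<in> (\<lambda>g. \<tau> \<circ> g) ` Aut" by blast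
    next
      fix \<sigma> assume "\<sigma> \<in> (\<lambda>g. \<tau> \<circ> g) ` Aut"
      then obtain g where g: "g permutes ?V" "(\<lambda>e. g ` e) ` ?E = ?E" "\<sigma> = \<tau> \<circ> g"
        by (auto simp: Aut_def)
      have \<sigma>: "\<sigma> permutes ?V" unfolding g(3) by (rule permutes_compose[OF g(1) \<tau>(1)])
      have "(\<lambda>e. \<sigma> ` e) ` ?E = (\<lambda>e. \<tau> ` e) ` (\<lambda>e. g ` e) ` ?E"
        unfolding g(3) by (simp add: image_image image_comp)
      hence "edges (T \<sigma>) = edges (T \<tau>)" by (simp only: edges_T g(2))
      hence "T \<sigma> = T \<tau>" using verts_T[OF \<sigma>] verts_T[OF \<tau>(1)]
        by (metis graph.expand)
      thus "\<sigma> \<in> {\<sigma> \<in> S. T \<sigma> = K}" using \<sigma> \<tau> by (simp add: S_def)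
    qed
    moreover have "inj_on (\<lambda>g. \<tau> \<circ> g) Aut"
      using permutes_inj[OF \<tau>(1)] by (auto intro!: inj_onI simp: fun_eq_iff inj_def)
    ultimately show ?thesis by (simp add: card_image)
  qed
  have "card S = (\<Sum>K\<in>T ` S. card {\<sigma> \<in> S. T \<sigma> = K})"
    using sum.image_gen[OF finS, of "\<lambda>_. 1::nat" T] by simp
  also have "\<dots> = card (copies_on G A) * card Aut" using fibre img by simp
  finally have eq: "fact (num_verts G) = card (copies_on G A) * num_automorphisms G"
    using card_permutations[OF _ finV, of "num_verts G"]
    by (simp add: S_def Aut_def num_automorphisms_def num_verts_def)
  hence "num_automorphisms G \<noteq> 0" by (metis fact_nonzero mult_0_right)
  moreover have "fact (num_verts G) = real (card (copies_on G A)) * real (num_automorphisms G)"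
    using arg_cong[OF eq, of real] by simp
  ultimately show ?thesis unfolding rho_def by (simp add: field_simps)
qed

text \<open>
  A copy of \<open>G\<close> inside \<open>V\<close> has a unique vertex set of size \<open>num_verts G\<close>. Thus the double sum over vertex
  sets and over copies on them is a single sum over the copies inside \<open>V\<close>.
\<close>

lemma copies_on_partition:
  assumes G: "simple_graph G" and V: "finite V"
  shows "(\<Sum>K | K \<in> copies_on G V \<and> R K. h K)
    = (\<Sum>A\<in>nsets V (num_verts G). \<Sum>K | K \<in> copies_on G A \<and> R K. h K)"
proof -
  have fin: "finite A" "card A = num_verts G" "A \<subseteq> V" if "A \<in> nsets V (num_verts G)" for A
    using that by (auto simp: nsets_def)
  have "{K. K \<in> copies_on G V \<and> R K}
      = (\<Union>A\<in>nsets V (num_verts G). {K. K \<in> copies_on G A \<and> R K})"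
  proof (intro equalityI subsetI)
    fix K assume K: "K \<in> {K. K \<in> copies_on G V \<and> R K}"
    hence "verts K \<in> nsets V (num_verts G)" "K \<in> copies_on G (verts K)"
      using copy_sizes(1)[OF G, of K V] V
      by (auto simp: nsets_def num_verts_def copies_on_iff intro: finite_subset)
    thus "K \<in> (\<Union>A\<in>nsets V (num_verts G). {K. K \<in> copies_on G A \<and> R K})" using K by blast
  qed (auto simp: copies_on_iff nsets_def)
  moreover have "A = A'" if "A \<in> nsets V (num_verts G)" "A' \<in> nsets V (num_verts G)"
    "K \<in> copies_on G A" "K \<in> copies_on G A'" for A A' K
    using verts_copy_full[OF G] fin that by metis
  ultimately show ?thesis
    using finite_imp_finite_nsets[OF V, of "num_verts G"] finite_copies_on[OF fin(1), of _ G]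
    by (simp only:) (subst sum.UNION_disjoint, auto intro: finite_subset[of _ "copies_on G _"])
qed

lemma num_copies_eq_card:
  assumes "simple_graph G" "finite (verts H)"
  shows "num_copies G H = card {K \<in> copies_on G (verts H). edges K \<subseteq> edges H}"
proof -
  have "finite A" if "A \<in> nsets (verts H) (num_verts G)" for A
    using that by (auto simp: nsets_def)
  hence inner: "(\<Sum>K\<in>copies_on G A. of_bool (edges K \<subseteq> edges H))
      = (\<Sum>K | K \<in> copies_on G A \<and> edges K \<subseteq> edges H. 1 :: nat)"
    if "A \<in> nsets (verts H) (num_verts G)" for A
    using that by (simp add: finite_copies_on Int_def)
  hence "num_copies G H = (\<Sum>A\<in>nsets (verts H) (num_verts G).
      \<Sum>K | K \<in> copies_on G A \<and> edges K \<subseteq> edges H. 1)"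
    unfolding num_copies_def by (rule sum.cong[OF refl])
  also have "\<dots> = card {K \<in> copies_on G (verts H). edges K \<subseteq> edges H}"
    by (subst copies_on_partition[OF assms, symmetric]) simp
  finally show ?thesis .
qed

lemma card_copies_with_verts:
  assumes G: "simple_graph G" and V: "finite V"
  shows "real (card {K \<in> copies_on G V. R (verts K)})
    = real (card {A \<in> nsets V (num_verts G). R A}) * rho G"
proof -
  have "real (card {K \<in> copies_on G V. R (verts K)})
      = (\<Sum>A\<in>nsets V (num_verts G). \<Sum>K | K \<in> copies_on G A \<and> R (verts K). 1)"
    by (subst copies_on_partition[OF assms, symmetric]) simp
  also have "\<dots> = (\<Sum>A\<in>nsets V (num_verts G). if R A then rho G else 0)"
  proof (rule sum.cong[OF refl])
    fix A assume "A \<in> nsets V (num_verts G)"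
    hence A: "finite A" "card A = num_verts G" by (auto simp: nsets_def)
    have "{K. K \<in> copies_on G A \<and> R (verts K)} = (if R A then copies_on G A else {})"
      using verts_copy_full[OF G _ A] by auto
    thus "(\<Sum>K | K \<in> copies_on G A \<and> R (verts K). 1) = (if R A then rho G else 0)"
      using card_copies_on[OF G A] by simp
  qed
  also have "\<dots> = real (card {A \<in> nsets V (num_verts G). R A}) * rho G"
    using finite_imp_finite_nsets[OF V, of "num_verts G"]
    by (simp add: sum.If_cases Int_def)
  finally show ?thesis .
qed

lemma card_nsets: "finite V \<Longrightarrow> card (nsets V k) = card V choose k"
proof -
  assume V: "finite V"
  hence "nsets V k = {B. B \<subseteq> V \<and> card B = k}" by (auto simp: nsets_def intro: finite_subset)
  thus ?thesis using n_subsets[OF V] by simp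
qed

lemma binomial_le_power_div_fact: "real (n choose k) \<le> real n ^ k / fact k"
proof -
  have "real ((n choose k) * fact k) \<le> real (n ^ k)"
    by (rule of_nat_mono[OF binomial_fact_pow])
  thus ?thesis by (simp add: pos_le_divide_eq)
qed

text \<open>
  A set that meets \<open>S\<close> is determined by a common point and its remaining \<open>k - 1\<close> elements.
\<close>

lemma card_nsets_meeting:
  assumes V: "finite V" and S: "finite S" and k: "k \<ge> 1"
  shows "card {A \<in> nsets V k. A \<inter> S \<noteq> {}} \<le> card S * (card V choose (k - 1))"
proof -
  have fin: "finite (nsets V (k - 1))" by (rule finite_imp_finite_nsets[OF V])
  have "{A \<in> nsets V k. A \<inter> S \<noteq> {}} \<subseteq> (\<Union>x\<in>S. insert x ` nsets V (k - 1))"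
  proof
    fix A assume A: "A \<in> {A \<in> nsets V k. A \<inter> S \<noteq> {}}"
    then obtain x where x: "x \<in> A" "x \<in> S" by auto
    have "A - {x} \<in> nsets V (k - 1)" using A x by (auto simp: nsets_def)
    moreover have "A = insert x (A - {x})" using x by auto
    ultimately show "A \<in> (\<Union>x\<in>S. insert x ` nsets V (k - 1))" using x by blast
  qed
  hence "card {A \<in> nsets V k. A \<inter> S \<noteq> {}} \<le> card (\<Union>x\<in>S. insert x ` nsets V (k - 1))"
    using S fin by (intro card_mono) auto
  also have "\<dots> \<le> (\<Sum>x\<in>S. card (insert x ` nsets V (k - 1)))" by (rule card_UN_le[OF S])
  also have "\<dots> \<le> (\<Sum>x\<in>S. card (nsets V (k - 1)))" by (intro sum_mono card_image_le fin)
  finally show ?thesis by (simp add: card_nsets[OF V])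
qed

text \<open>
  Split \<open>A\<close> into \<open>S \<inter> A\<close> and \<open>A - S\<close>; the second part is chosen crudely among all \<open>(k - s)\<close>-subsets of \<open>V\<close>.
\<close>

lemma card_nsets_overlap:
  assumes V: "finite V" and S: "finite S"
  shows "card {A \<in> nsets V k. card (S \<inter> A) = s} \<le> (card S choose s) * (card V choose (k - s))"
proof -
  have fin: "finite (nsets V (k - s))" "finite (nsets S s)"
    using V S by (simp_all add: finite_imp_finite_nsets)
  have "{A \<in> nsets V k. card (S \<inter> A) = s} \<subseteq> (\<lambda>(B, C). B \<union> C) ` (nsets S s \<times> nsets V (k - s))"
  proof
    fix A assume A: "A \<in> {A \<in> nsets V k. card (S \<inter> A) = s}"
    hence "card (A - S) = k - s"
      by (subst card_Diff_subset_Int) (auto simp: nsets_def Int_commute)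
    hence "A - S \<in> nsets V (k - s)" "S \<inter> A \<in> nsets S s" using A by (auto simp: nsets_def)
    moreover have "A = (S \<inter> A) \<union> (A - S)" by auto
    ultimately show "A \<in> (\<lambda>(B, C). B \<union> C) ` (nsets S s \<times> nsets V (k - s))"
      by (intro image_eqI[of _ _ "(S \<inter> A, A - S)"]) auto
  qed
  hence "card {A \<in> nsets V k. card (S \<inter> A) = s}
      \<le> card ((\<lambda>(B, C). B \<union> C) ` (nsets S s \<times> nsets V (k - s)))"
    using fin by (intro card_mono) auto
  also have "\<dots> \<le> card (nsets S s \<times> nsets V (k - s))"
    using fin by (intro card_image_le) auto
  finally show ?thesis by (simp add: card_cartesian_product card_nsets V S)
qed

section \<open>Edges outside a small subgraph\<close>

lemma finite_proper_subgraphs: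
  assumes "simple_graph G"
  shows "finite (proper_subgraphs G)"
proof (rule finite_subset)
  show "proper_subgraphs G \<subseteq> (\<lambda>(V, E). Graph V E) ` (Pow (verts G) \<times> Pow (edges G))"
  proof
    fix K assume "K \<in> proper_subgraphs G"
    hence "verts K \<subseteq> verts G" "edges K \<subseteq> edges G"
      by (auto simp: proper_subgraphs_def subgraph_def)
    thus "K \<in> (\<lambda>(V, E). Graph V E) ` (Pow (verts G) \<times> Pow (edges G))"
      by (intro image_eqI[of _ _ "(verts K, edges K)"]) auto
  qed
qed (use assms simple_graph_finite_edges[OF assms] in \<open>simp add: simple_graph_def\<close>)

text \<open>
  For nonempty \<open>F\<close> the graph \<open>H\<close> with edges \<open>F\<close> on the \<open>t \<le> s\<close> vertices they cover is one of the subgraphs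
  over which \<open>alpha\<close> and \<open>gamma\<close> are minimised, and it has fewer vertices than \<open>G\<close>. Both
  lower bounds for the number of missing edges then get weaker when \<open>t\<close> is replaced by \<open>s\<close>. For empty
  \<open>F\<close>, add an arbitrary edge: it covers \<open>2 \<le> s\<close> vertices.
\<close>

lemma kappa_le_missing_edges:
  assumes G: "simple_graph G" "num_edges G > 0"
    and F: "F \<subseteq> edges G" "card (\<Union>F) \<le> s" and s: "2 \<le> s" "s < num_verts G"
  shows "kappa G s \<le> real (num_edges G) - real (card F)"
proof -
  have finV: "finite (verts G)" and finE: "finite (edges G)"
    using G(1) simple_graph_finite_edges by (auto simp: simple_graph_def)
  have nonempty: "kappa G s \<le> real (num_edges G) - real (card F)"
    if F: "F \<subseteq> edges G" "card (\<Union>F) \<le> s" "F \<noteq> {}" for F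
  proof -
    define H where "H = Graph (\<Union>F) F"
    define v t e where "v = real (num_verts G)" and "t = real (card (\<Union>F))"
      and "e = real (num_edges G)"
    have sub: "\<Union>F \<subseteq> verts G" using F(1) simple_graph_edge(1)[OF G(1)] by blast
    have "F \<subseteq> nsets (\<Union>F) 2"
      using F(1) simple_graph_edge[OF G(1)] by (auto simp: nsets_def)
    hence "subgraph H G"
      using F(1) sub finV by (auto simp: H_def subgraph_def simple_graph_def intro: finite_subset)
    moreover have "verts H \<noteq> {}"
    proof -
      obtain e where "e \<in> F" using F(3) by auto
      moreover from this have "e \<noteq> {}" using F(1) simple_graph_edge(2)[OF G(1), of e] by auto
      ultimately show ?thesis by (auto simp: H_def)
    qed
    moreover have nv: "num_verts H = card (\<Union>F)" by (simp add: H_def num_verts_def)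
    moreover have ne: "num_edges H = card F" by (simp add: H_def num_edges_def)
    moreover have neq: "num_verts H \<noteq> num_verts G" using nv F(2) s by linarith
    ultimately have H: "H \<in> proper_subgraphs G"
      unfolding proper_subgraphs_def by (auto simp: no_isolated_verts_def H_def)
    have vts: "t \<le> real s" "real s < v" using F(2) s by (simp_all add: t_def v_def)
    have cF: "real (card F) \<le> e"
      using card_mono[OF finE F(1)] by (simp add: e_def num_edges_def)
    have "gamma G \<le> edge_density G * real (num_verts H) - real (num_edges H)"
      unfolding gamma_def using finite_proper_subgraphs[OF G(1)] H by (intro Min_le) auto
    hence "gamma G \<le> edge_density G * t - real (card F)" by (simp add: nv ne t_def)
    moreover have "edge_density G * t \<le> edge_density G * real s"
      using vts by (intro mult_left_mono) (auto simp: edge_density_def)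
    ultimately have 1: "e - real s * edge_density G + gamma G \<le> e - real (card F)"
      by (simp add: mult.commute)
    have "alpha G \<le> (real (num_edges G) - real (num_edges H)) / (real (num_verts G) - real (num_verts H))"
      unfolding alpha_def using finite_proper_subgraphs[OF G(1)] H neq by (intro Min_le) auto
    hence "alpha G \<le> (e - real (card F)) / (v - t)" by (simp add: nv ne t_def e_def v_def)
    hence "(v - real s) * alpha G \<le> (v - real s) * ((e - real (card F)) / (v - t))"
      using vts by (intro mult_left_mono) auto
    also have "\<dots> \<le> (v - t) * ((e - real (card F)) / (v - t))"
      using vts cF by (intro mult_right_mono divide_nonneg_nonneg) auto
    also have "\<dots> = e - real (card F)" using vts by simp
    finally show ?thesis using 1 by (simp add: kappa_def e_def v_def)
  qed
  show ?thesis
  proof (cases "F = {}")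
    case True
    obtain e where e: "e \<in> edges G"
      using G(2) by (metis num_edges_def card.empty equals0I less_irrefl)
    have "kappa G s \<le> real (num_edges G) - real (card {e})"
      using e s simple_graph_edge[OF G(1) e] by (intro nonempty) auto
    thus ?thesis using True by simp
  qed (use F nonempty in blast)
qed

text \<open>
  The edges that \<open>L\<close> shares with \<open>K\<close> are pulled back to \<open>G\<close>, where they cover at most \<open>s\<close> vertices.
\<close>

lemma kappa_le_new_edges:
  assumes G: "simple_graph G" "num_edges G > 0"
    and K: "simple_graph K" and L: "L \<in> copies_on G A"
    and s: "card (verts K \<inter> verts L) = s" "2 \<le> s" "s < num_verts G"
  shows "kappa G s \<le> real (card (edges L - edges K))"
proof -
  obtain \<phi> where \<phi>: "inj_on \<phi> (verts G)" "L = graph_image \<phi> G"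
    using L graph_iso_obtain_image by (metis copies_on_iff)
  define F where "F = {e \<in> edges G. \<phi> ` e \<in> edges K}"
  have inj: "inj_on (\<lambda>e. \<phi> ` e) F"
    using inj_on_image_edges[OF G(1) \<phi>(1)] by (rule inj_on_subset) (auto simp: F_def)
  have finE: "finite (edges L)"
    using L simple_graph_finite_edges by (auto simp: copies_on_iff)
  have F_img: "(\<lambda>e. \<phi> ` e) ` F = edges L \<inter> edges K" by (auto simp: F_def \<phi>(2))
  have sub: "\<Union>F \<subseteq> verts G" using simple_graph_edge(1)[OF G(1)] by (auto simp: F_def)
  have "\<phi> ` \<Union>F \<subseteq> verts K \<inter> verts L"
    using sub simple_graph_edge(1)[OF K] by (auto simp: F_def \<phi>(2))
  moreover have "card (\<phi> ` \<Union>F) = card (\<Union>F)"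
    by (rule card_image[OF inj_on_subset[OF \<phi>(1) sub]])
  moreover have "finite (verts K \<inter> verts L)" using K by (simp add: simple_graph_def)
  ultimately have "card (\<Union>F) \<le> s" using s(1) by (metis card_mono)
  hence "kappa G s \<le> real (num_edges G) - real (card F)"
    using s by (intro kappa_le_missing_edges[OF G]) (auto simp: F_def)
  also have "card F = card (edges L \<inter> edges K)" using card_image[OF inj] F_img by simp
  also have "real (num_edges G) = real (card (edges L))"
    using copy_sizes(2)[OF G(1) L] by (simp add: num_edges_def)
  also have "real (card (edges L)) - real (card (edges L \<inter> edges K)) = real (card (edges L - edges K))"
    using finE card_mono[OF finE, of "edges L \<inter> edges K"] by (simp add: card_Diff_subset_Int of_nat_diff)
  finally show ?thesis .
qed


section \<open>Overlapping copies in the block model\<close>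

context stochastic_block_model
begin

context
  fixes G :: "nat graph"
  assumes G: "simple_graph G" "verts G = {1..num_verts G}" "num_edges G > 0"
begin

abbreviation copies :: "nat graph set" where
  "copies \<equiv> copies_on G {1..n}"

lemma copy_edges:
  assumes "K \<in> copies"
  shows "edges K \<subseteq> nsets (verts K) 2" "verts K \<subseteq> {1..n}" "edges K \<subseteq> nsets {1..n} 2"
    "finite (verts K)" "card (verts K) = num_verts G" "finite (edges K)" "card (edges K) = num_edges G"
  using assms copy_sizes[OF G(1) assms] nsets_mono[of "verts K" "{1..n}" 2] simple_graph_finite_edges[of K]
  by (auto simp: copies_on_iff simple_graph_def num_verts_def num_edges_def)

lemma edges_prob_copy:
  assumes K: "K \<in> copies"
  shows "edges_prob (edges K) = mu Q \<pi> f G"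
proof -
  obtain \<phi> where \<phi>: "inj_on \<phi> (verts G)" "K = graph_image \<phi> G"
    using K graph_iso_obtain_image by (metis copies_on_iff)
  thus ?thesis using edges_prob_relabel[OF G(1,2) \<phi>(1)] copy_edges(2)[OF K] by simp
qed

lemma copies_pmf_eq:
  "copies_pmf n Q \<pi> f G = map_pmf (\<lambda>H. card {K \<in> copies. edges K \<subseteq> edges H}) (SBM n Q \<pi> f)"
  unfolding copies_pmf_def
  by (intro map_pmf_cong refl) (simp add: num_copies_eq_card[OF G(1)] verts_SBM)

lemma card_copies: "real (card copies) = real (n choose num_verts G) * rho G"
  using card_copies_with_verts[OF G(1), of "{1..n}" "\<lambda>_. True"] by (simp add: card_nsets)

lemma expectation_copies:
  "measure_pmf.expectation (copies_pmf n Q \<pi> f G) real = (\<Sum>K\<in>copies. edges_prob (edges K))"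
proof -
  have "real (card {K \<in> copies. edges K \<subseteq> edges H}) = (\<Sum>K\<in>copies. of_bool (edges K \<subseteq> edges H))" for H
    by (simp add: finite_copies_on Int_def)
  hence "measure_pmf.expectation (copies_pmf n Q \<pi> f G) real
      = expect (\<lambda>H. \<Sum>K\<in>copies. of_bool (edges K \<subseteq> edges H))"
    unfolding copies_pmf_eq by simp
  also have "\<dots> = (\<Sum>K\<in>copies. edges_prob (edges K))"
    unfolding edges_prob_def
    by (intro Bochner_Integration.integral_sum integrable_measure_pmf_finite[OF finite_set_SBM])
  finally show ?thesis .
qed

lemma mean_copies:
  "measure_pmf.expectation (copies_pmf n Q \<pi> f G) real
    = real (n choose num_verts G) * rho G * mu Q \<pi> f G"
proof -
  have "(\<Sum>K\<in>copies. edges_prob (edges K)) = real (card copies) * mu Q \<pi> f G"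
    by (simp add: edges_prob_copy)
  thus ?thesis by (simp only: expectation_copies card_copies)
qed

lemma num_verts_ge_2: "num_verts G \<ge> 2"
proof -
  obtain e where e: "e \<in> edges G"
    using G(3) by (metis num_edges_def card.empty equals0I less_irrefl)
  show ?thesis
    using simple_graph_edge[OF G(1) e] G(1) card_mono[of "verts G" e]
    by (simp add: simple_graph_def num_verts_def)
qed

lemma rho_nonneg: "rho G \<ge> 0"
  by (simp add: rho_def)

lemma card_copies_meeting:
  assumes S: "finite S" "card S = num_verts G"
  shows "real (card {L \<in> copies. verts L \<inter> S \<noteq> {}})
    \<le> rho G * ((real (num_verts G))\<^sup>2 / fact (num_verts G) * real n ^ (num_verts G - 1))"
proof -
  let ?v = "num_verts G"
  have v: "?v \<ge> 1" using num_verts_ge_2 by simp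
  have "real (card {A \<in> nsets {1..n} ?v. A \<inter> S \<noteq> {}}) \<le> real (?v * (n choose (?v - 1)))"
    using card_nsets_meeting[OF _ S(1) v, of "{1..n}"] S(2) by (intro of_nat_mono) simp
  also have "\<dots> \<le> real ?v * (real n ^ (?v - 1) / fact (?v - 1))"
    unfolding of_nat_mult by (intro mult_left_mono binomial_le_power_div_fact) simp
  also have "\<dots> = (real ?v)\<^sup>2 / fact ?v * real n ^ (?v - 1)"
  proof -
    have "fact ?v = real ?v * fact (?v - 1)" using v by (intro fact_reduce) simp
    thus ?thesis using v by (simp add: power2_eq_square)
  qed
  finally have "real (card {A \<in> nsets {1..n} ?v. A \<inter> S \<noteq> {}}) * rho G
    \<le> (real ?v)\<^sup>2 / fact ?v * real n ^ (?v - 1) * rho G"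
    using rho_nonneg by (rule mult_right_mono)
  moreover have "real (card {L \<in> copies. verts L \<inter> S \<noteq> {}})
      = real (card {A \<in> nsets {1..n} ?v. A \<inter> S \<noteq> {}}) * rho G"
    by (rule card_copies_with_verts[OF G(1)]) simp
  ultimately show ?thesis by (simp only: mult.commute)
qed

lemma card_copies_overlap:
  assumes S: "finite S" "card S = num_verts G"
  shows "real (card {L \<in> copies. card (S \<inter> verts L) = s})
    \<le> rho G * (real (num_verts G choose s) * (real n ^ (num_verts G - s) / fact (num_verts G - s)))"
proof -
  let ?v = "num_verts G"
  have "real (card {A \<in> nsets {1..n} ?v. card (S \<inter> A) = s}) \<le> real ((?v choose s) * (n choose (?v - s)))"
    using card_nsets_overlap[OF _ S(1), of "{1..n}" ?v s] S(2) by (intro of_nat_mono) simp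
  also have "\<dots> \<le> real (?v choose s) * (real n ^ (?v - s) / fact (?v - s))"
    unfolding of_nat_mult by (intro mult_left_mono binomial_le_power_div_fact) simp
  finally have "real (card {A \<in> nsets {1..n} ?v. card (S \<inter> A) = s}) * rho G
    \<le> real (?v choose s) * (real n ^ (?v - s) / fact (?v - s)) * rho G"
    using rho_nonneg by (rule mult_right_mono)
  moreover have "real (card {L \<in> copies. card (S \<inter> verts L) = s})
      = real (card {A \<in> nsets {1..n} ?v. card (S \<inter> A) = s}) * rho G"
    by (rule card_copies_with_verts[OF G(1)]) simp
  ultimately show ?thesis by (simp only: mult.commute)
qed

text \<open>
  Bounds the total of \<open>max_prob\<close> to the number of new edges, over the copies sharing exactly \<open>s\<close> vertices
  with a given copy, per unit of \<open>rho G\<close>. For \<open>s = 1\<close> the counting factor \<open>(v choose s) * n ^ (v - s) / (v - s)!\<close> has been rewritten as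
  \<open>v\<^sup>2 / v! * n ^ (v - 1)\<close>, to match the bound on all copies that meet the given one.
\<close>

definition overlap_bound :: "nat \<Rightarrow> real" where
  "overlap_bound s =
     (if s = 1 then (real (num_verts G))\<^sup>2 / fact (num_verts G)
          * real n ^ (num_verts G - 1) * max_prob Q \<pi> ^ num_edges G
      else if s = num_verts G then max_prob Q \<pi>
      else real (num_verts G choose s)
          * (real n ^ (num_verts G - s) * max_prob Q \<pi> powr kappa G s) / fact (num_verts G - s))"

text \<open>
  The exponent is bounded below in three regimes. Copies with one common vertex share no edge, so all
  edges are new. Distinct copies on the same vertex set have equally many edges, so at least one is new.
  In between, there are at least \<open>kappa G s\<close> new edges; positivity of \<open>max_prob\<close> is needed to pass from
  powers with natural exponents to \<open>powr\<close>.
\<close>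

lemma sum_overlap_le:
  assumes p: "max_prob Q \<pi> > 0" and K: "K \<in> copies" and s: "1 \<le> s" "s \<le> num_verts G"
  shows "(\<Sum>L | L \<in> copies \<and> L \<noteq> K \<and> card (verts K \<inter> verts L) = s.
           max_prob Q \<pi> ^ card (edges L - edges K)) \<le> rho G * overlap_bound s"
    (is "(\<Sum>L\<in>?S. _) \<le> _")
proof -
  let ?p = "max_prob Q \<pi>" and ?v = "num_verts G"
  note Ke = copy_edges[OF K]
  have count: "(\<Sum>L\<in>?S. ?p ^ card (edges L - edges K)) \<le> rho G * (N * w)"
    if "\<And>L. L \<in> ?S \<Longrightarrow> ?p ^ card (edges L - edges K) \<le> w"
      "real (card T) \<le> rho G * N" "?S \<subseteq> T" "T \<subseteq> copies" "w \<ge> 0" for N w T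
  proof -
    have "(\<Sum>L\<in>?S. ?p ^ card (edges L - edges K)) \<le> real (card ?S) * w"
      using sum_mono[of ?S "\<lambda>L. ?p ^ card (edges L - edges K)" "\<lambda>_. w"] that(1) by simp
    also have "\<dots> \<le> real (card T) * w"
      using that finite_subset[OF that(4) finite_copies_on]
      by (intro mult_right_mono of_nat_mono card_mono) auto
    also have "\<dots> \<le> rho G * N * w" using that by (intro mult_right_mono) auto
    finally show ?thesis by (simp only: mult.assoc)
  qed
  consider "s = 1" | "s = ?v" "s \<noteq> 1" | "2 \<le> s" "s < ?v" using s by linarith
  thus ?thesis
  proof cases
    case 1
    have "?p ^ card (edges L - edges K) \<le> ?p ^ num_edges G" if "L \<in> ?S" for L
    proof -
      have L: "L \<in> copies" "card (verts K \<inter> verts L) = 1" using that 1 by auto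
      have "edges L \<inter> edges K = {}"
      proof (rule ccontr)
        assume "edges L \<inter> edges K \<noteq> {}"
        then obtain e where "e \<in> edges L" "e \<in> edges K" by auto
        hence "e \<subseteq> verts K \<inter> verts L" "card e = 2"
          using Ke(1) copy_edges(1)[OF L(1)] by (auto simp: nsets_def)
        thus False using L(2) Ke(4) card_mono[of "verts K \<inter> verts L" e] by simp
      qed
      thus ?thesis using copy_edges(7)[OF L(1)] by (simp add: Diff_triv)
    qed
    moreover have "?S \<subseteq> {L \<in> copies. verts L \<inter> verts K \<noteq> {}}" using 1 by (auto simp: Int_commute)
    ultimately show ?thesis
      using count[OF _ card_copies_meeting[OF Ke(4,5)]] 1 p by (simp add: overlap_bound_def)
  next
    case 2
    have "?p ^ card (edges L - edges K) \<le> ?p" if "L \<in> ?S" for L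
    proof -
      have L: "L \<in> copies" "L \<noteq> K" "card (verts K \<inter> verts L) = ?v" using that 2 by auto
      have "verts K \<inter> verts L = verts K" "verts K \<inter> verts L = verts L"
        using card_subset_eq[OF Ke(4) Int_lower1] card_subset_eq[OF copy_edges(4)[OF L(1)] Int_lower2]
          L(3) Ke(5) copy_edges(5)[OF L(1)] by simp_all
      hence "edges L \<noteq> edges K" using L(2) by (metis graph.expand)
      hence "edges L - edges K \<noteq> {}"
        using card_subset_eq[OF Ke(6), of "edges L"] Ke(7) copy_edges(7)[OF L(1)] by auto
      hence "1 \<le> card (edges L - edges K)"
        using copy_edges(6)[OF L(1)] by (simp add: card_gt_0_iff Suc_le_eq)
      thus ?thesis using power_decreasing[of 1 _ ?p] p max_prob_bounds(2) by simp
    qed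
    from count[OF this card_copies_overlap[OF Ke(4,5), of s]] show ?thesis
      using 2 p by (auto simp: overlap_bound_def)
  next
    case 3
    have "?p ^ card (edges L - edges K) \<le> ?p powr kappa G s" if "L \<in> ?S" for L
    proof -
      have "kappa G s \<le> real (card (edges L - edges K))"
        using that K 3 by (intro kappa_le_new_edges[OF G(1,3)]) (auto simp: copies_on_iff)
      thus ?thesis using p max_prob_bounds(2)
        by (simp add: powr_mono' flip: powr_realpow)
    qed
    from count[OF this card_copies_overlap[OF Ke(4,5), of s]] show ?thesis
      using 3 p by (auto simp: overlap_bound_def mult_ac)
  qed
qed

lemma sum_overlap_bound:
  "(\<Sum>s = 1..num_verts G. overlap_bound s)
    = (real (num_verts G))\<^sup>2 / fact (num_verts G) * real n ^ (num_verts G - 1) * max_prob Q \<pi> ^ num_edges G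
      + max_prob Q \<pi>
      + (\<Sum>s = 2..num_verts G - 1. real (num_verts G choose s)
          * (real n ^ (num_verts G - s) * max_prob Q \<pi> powr kappa G s) / fact (num_verts G - s))"
proof -
  have "{1..num_verts G} = insert 1 (insert (num_verts G) {2..num_verts G - 1})"
    using num_verts_ge_2 by auto
  moreover have "(\<Sum>s = 2..num_verts G - 1. overlap_bound s)
    = (\<Sum>s = 2..num_verts G - 1. real (num_verts G choose s)
          * (real n ^ (num_verts G - s) * max_prob Q \<pi> powr kappa G s) / fact (num_verts G - s))"
    by (rule sum.cong) (auto simp: overlap_bound_def)
  ultimately show ?thesis
    using num_verts_ge_2 by (simp add: overlap_bound_def)
qed

text \<open>
  The contribution of a single copy \<open>K\<close> to the Stein--Chen bound. Its first summand and the overlaps in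
  exactly one vertex are both at most \<open>mu * rho * v\<^sup>2 / v! * n ^ (v - 1) * max_prob ^ e\<close>, whence the factor 2.
\<close>

lemma neighbourhood_sum_le:
  assumes p: "max_prob Q \<pi> > 0" and K: "K \<in> copies"
  defines "N \<equiv> {L \<in> copies. verts L \<inter> verts K \<noteq> {}}"
  shows "edges_prob (edges K) * (\<Sum>L\<in>N. edges_prob (edges L))
      + (\<Sum>L\<in>N - {K}. edges_prob (edges K \<union> edges L))
    \<le> mu Q \<pi> f G * (rho G *
      (2 * (real (num_verts G))\<^sup>2 / fact (num_verts G)
           * real n ^ (num_verts G - 1) * max_prob Q \<pi> ^ num_edges G
         + max_prob Q \<pi>
         + (\<Sum>s = 2..num_verts G - 1.
              real (num_verts G choose s)
                * (real n ^ (num_verts G - s) * max_prob Q \<pi> powr kappa G s)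
                / fact (num_verts G - s))))"
proof -
  let ?p = "max_prob Q \<pi>" and ?m = "mu Q \<pi> f G" and ?v = "num_verts G"
  define B where "B = (real ?v)\<^sup>2 / fact ?v * real n ^ (?v - 1) * ?p ^ num_edges G"
  note Ke = copy_edges[OF K]
  have finN: "finite N" unfolding N_def by (simp add: finite_copies_on)
  have m: "?m \<ge> 0" "?m \<le> ?p ^ num_edges G"
    using edges_prob_nonneg[of "edges K"] edges_prob_le[OF Ke(3)] Ke(7) edges_prob_copy[OF K] by simp_all
  have "edges_prob (edges K) * (\<Sum>L\<in>N. edges_prob (edges L)) = ?m * (real (card N) * ?m)"
    using K by (simp add: edges_prob_copy N_def)
  also have "\<dots> \<le> ?m * (rho G * ((real ?v)\<^sup>2 / fact ?v * real n ^ (?v - 1)) * ?p ^ num_edges G)"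
    using m rho_nonneg card_copies_meeting[OF Ke(4,5)] unfolding N_def
    by (intro mult_left_mono mult_mono) auto
  finally have 1: "edges_prob (edges K) * (\<Sum>L\<in>N. edges_prob (edges L)) \<le> ?m * (rho G * B)"
    by (simp add: B_def mult.assoc)
  have "(\<Sum>L\<in>N - {K}. edges_prob (edges K \<union> edges L))
      \<le> (\<Sum>L\<in>N - {K}. ?m * ?p ^ card (edges L - edges K))"
    using edges_prob_Un_le[OF Ke(3) copy_edges(3)] edges_prob_copy[OF K]
    by (intro sum_mono) (auto simp: N_def)
  also have "\<dots> = ?m * (\<Sum>L\<in>N - {K}. ?p ^ card (edges L - edges K))"
    by (simp add: sum_distrib_left)
  also have "(\<Sum>L\<in>N - {K}. ?p ^ card (edges L - edges K))
      = (\<Sum>s = 1..?v. \<Sum>L | L \<in> N - {K} \<and> card (verts K \<inter> verts L) = s. ?p ^ card (edges L - edges K))"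
  proof (rule sum.group[symmetric])
    show "(\<lambda>L. card (verts K \<inter> verts L)) ` (N - {K}) \<subseteq> {1..?v}"
    proof (rule image_subsetI)
      fix L assume "L \<in> N - {K}"
      hence "verts K \<inter> verts L \<noteq> {}" by (auto simp: N_def)
      moreover have "card (verts K \<inter> verts L) \<le> ?v" using Ke(4,5) card_mono[of "verts K"] by fastforce
      ultimately show "card (verts K \<inter> verts L) \<in> {1..?v}"
        using Ke(4) by (simp add: Suc_le_eq card_gt_0_iff)
    qed
  qed (use finN in auto)
  also have "\<dots> \<le> (\<Sum>s = 1..?v. rho G * overlap_bound s)"
  proof (rule sum_mono)
    fix s assume s: "s \<in> {1..?v}"
    have "{L. L \<in> N - {K} \<and> card (verts K \<inter> verts L) = s}
        \<subseteq> {L. L \<in> copies \<and> L \<noteq> K \<and> card (verts K \<inter> verts L) = s}"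
      by (auto simp: N_def)
    hence "(\<Sum>L | L \<in> N - {K} \<and> card (verts K \<inter> verts L) = s. ?p ^ card (edges L - edges K))
        \<le> (\<Sum>L | L \<in> copies \<and> L \<noteq> K \<and> card (verts K \<inter> verts L) = s. ?p ^ card (edges L - edges K))"
      using p by (intro sum_mono2) (auto simp: finite_copies_on)
    also have "\<dots> \<le> rho G * overlap_bound s" using sum_overlap_le[OF p K] s by simp
    finally show "(\<Sum>L | L \<in> N - {K} \<and> card (verts K \<inter> verts L) = s. ?p ^ card (edges L - edges K))
        \<le> rho G * overlap_bound s" .
  qed
  finally have 2: "(\<Sum>L\<in>N - {K}. edges_prob (edges K \<union> edges L))
      \<le> ?m * (rho G * (\<Sum>s = 1..?v. overlap_bound s))"
    using m(1) by (simp add: mult_left_mono flip: sum_distrib_left)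
  from add_mono[OF 1 2[unfolded sum_overlap_bound B_def[symmetric]]] show ?thesis
    by (simp add: B_def algebra_simps)
qed

text \<open>
  Since the bound for one copy contains the factor \<open>mu\<close>, summing it over all copies produces the factor
  \<open>l\<close>, which cancels the denominator of the Stein constant.
\<close>

lemma copies_poisson_approximation:
  fixes l :: real
  defines "l \<equiv> measure_pmf.expectation (copies_pmf n Q \<pi> f G) real"
  assumes l: "l > 0"
  shows "\<bar>measure_pmf.prob (copies_pmf n Q \<pi> f G) A - measure_pmf.prob (poisson_pmf l) A\<bar>
    \<le> (1 - exp (- l)) * rho G *
        (2 * (real (num_verts G))\<^sup>2 / fact (num_verts G)
           * real n ^ (num_verts G - 1) * max_prob Q \<pi> ^ num_edges G
         + max_prob Q \<pi>
         + (\<Sum>s = 2..num_verts G - 1.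
              real (num_verts G choose s)
                * (real n ^ (num_verts G - s) * max_prob Q \<pi> powr kappa G s)
                / fact (num_verts G - s)))"
    (is "_ \<le> (1 - exp (- l)) * rho G * ?b")
proof -
  define N where "N = (\<lambda>K. {L \<in> copies. verts L \<inter> verts K \<noteq> {}})"
  have fin: "finite copies" by (simp add: finite_copies_on)
  have mean: "l = (\<Sum>K\<in>copies. edges_prob (edges K))" by (simp add: l_def expectation_copies)
  have l_mu: "l = real (card copies) * mu Q \<pi> f G" by (simp add: mean edges_prob_copy)
  hence "copies \<noteq> {}" "mu Q \<pi> f G \<noteq> 0" using l by auto
  then obtain K0 where K0: "K0 \<in> copies" "edges_prob (edges K0) \<noteq> 0" using edges_prob_copy by fastforce
  \<comment> \<open>If \<open>max_prob\<close> were 0 no edge could occur, and \<open>l\<close> would vanish.\<close>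
  have p: "max_prob Q \<pi> > 0"
    using edges_prob_le[OF copy_edges(3)[OF K0(1)]] copy_edges(7)[OF K0(1)] K0(2) G(3)
      edges_prob_nonneg[of "edges K0"] max_prob_bounds(1)
    by (cases "max_prob Q \<pi> = 0") (auto simp: power_0_left)
  have "\<bar>measure_pmf.prob (map_pmf (\<lambda>H. card {K \<in> copies. edges K \<subseteq> edges H}) (SBM n Q \<pi> f)) A
        - measure_pmf.prob (poisson_pmf l) A\<bar>
    \<le> (1 - exp (- l)) / l *
      (\<Sum>K\<in>copies. expect (\<lambda>H. of_bool (edges K \<subseteq> edges H)) * (\<Sum>L\<in>N K. expect (\<lambda>H. of_bool (edges L \<subseteq> edges H)))
         + (\<Sum>L\<in>N K - {K}. expect (\<lambda>H. of_bool (edges K \<subseteq> edges H \<and> edges L \<subseteq> edges H))))"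
  proof (rule stein_chen_local[OF finite_set_SBM fin])
    fix K assume K: "K \<in> copies"
    show "K \<in> N K \<and> N K \<subseteq> copies"
      using K copy_edges(5)[OF K] num_verts_ge_2 by (auto simp: N_def)
  next
    fix K and g :: "nat \<Rightarrow> real" assume K: "K \<in> copies"
    let ?B = "{1..n} - verts K"
    show "expect (\<lambda>H. of_bool (edges K \<subseteq> edges H) * g (card {L \<in> copies - N K. edges L \<subseteq> edges H}))
      = expect (\<lambda>H. of_bool (edges K \<subseteq> edges H)) * expect (\<lambda>H. g (card {L \<in> copies - N K. edges L \<subseteq> edges H}))"
    proof (rule expect_indep[where A = "verts K" and B = ?B])
      fix H H' :: "nat graph"
      assume "edges H \<inter> nsets (verts K) 2 = edges H' \<inter> nsets (verts K) 2"
      hence "edges K \<subseteq> edges H \<longleftrightarrow> edges K \<subseteq> edges H'" using copy_edges(1)[OF K] by blast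
      thus "of_bool (edges K \<subseteq> edges H) = (of_bool (edges K \<subseteq> edges H') :: real)" by simp
    next
      fix H H' :: "nat graph"
      assume eq: "edges H \<inter> nsets ?B 2 = edges H' \<inter> nsets ?B 2"
      have "edges L \<subseteq> edges H \<longleftrightarrow> edges L \<subseteq> edges H'" if L: "L \<in> copies - N K" for L
      proof -
        have "verts L \<subseteq> ?B" using L copy_edges(2)[of L] by (auto simp: N_def)
        hence "edges L \<subseteq> nsets ?B 2" using L copy_edges(1)[of L] nsets_mono by blast
        thus ?thesis using eq by blast
      qed
      hence "{L \<in> copies - N K. edges L \<subseteq> edges H} = {L \<in> copies - N K. edges L \<subseteq> edges H'}" by blast
      thus "g (card {L \<in> copies - N K. edges L \<subseteq> edges H}) = g (card {L \<in> copies - N K. edges L \<subseteq> edges H'})"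
        by simp
    qed (use copy_edges(2)[OF K] in auto)
  qed (use mean l in \<open>simp_all add: edges_prob_def\<close>)
  hence "\<bar>measure_pmf.prob (copies_pmf n Q \<pi> f G) A - measure_pmf.prob (poisson_pmf l) A\<bar>
    \<le> (1 - exp (- l)) / l *
      (\<Sum>K\<in>copies. edges_prob (edges K) * (\<Sum>L\<in>N K. edges_prob (edges L))
         + (\<Sum>L\<in>N K - {K}. edges_prob (edges K \<union> edges L)))"
    by (simp add: copies_pmf_eq edges_prob_def)
  also have "\<dots> \<le> (1 - exp (- l)) / l * (\<Sum>K\<in>copies. mu Q \<pi> f G * (rho G * ?b))"
    using l unfolding N_def by (intro mult_left_mono sum_mono neighbourhood_sum_le[OF p]) auto
  also have "\<dots> = (1 - exp (- l)) / l * (l * (rho G * ?b))"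
    by (simp only: sum_constant l_mu mult.assoc)
  also have "\<dots> = (1 - exp (- l)) * rho G * ?b" using l by (simp only: divide_inverse) simp
  finally show ?thesis .
qed

lemma copies_pmf_mean_0:
  assumes "measure_pmf.expectation (copies_pmf n Q \<pi> f G) real = 0"
  shows "copies_pmf n Q \<pi> f G = return_pmf 0"
proof -
  have "finite (set_pmf (copies_pmf n Q \<pi> f G))"
    by (simp add: copies_pmf_def finite_set_SBM)
  hence "integrable (measure_pmf (copies_pmf n Q \<pi> f G)) real"
    by (rule integrable_measure_pmf_finite)
  hence "AE k in copies_pmf n Q \<pi> f G. real k = 0"
    using assms integral_nonneg_eq_0_iff_AE[of "measure_pmf (copies_pmf n Q \<pi> f G)" real] by simp
  thus ?thesis by (auto simp: AE_measure_pmf_iff set_pmf_subset_singleton[symmetric])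
qed

end

end

theorem theorem2p1:
  fixes n Q :: nat and f :: "nat \<Rightarrow> real" and \<pi> :: "nat \<Rightarrow> nat \<Rightarrow> real"
    and G :: "nat graph" and l :: real
  assumes "n \<ge> 1" and "Q \<ge> 1"
    and "\<And>a. a \<in> {1..Q} \<Longrightarrow> f a > 0"
    and "(\<Sum>a = 1..Q. f a) = 1"
    and "\<And>a b. a \<in> {1..Q} \<Longrightarrow> b \<in> {1..Q} \<Longrightarrow> \<pi> a b = \<pi> b a"
    and "\<And>a b. a \<in> {1..Q} \<Longrightarrow> b \<in> {1..Q} \<Longrightarrow> 0 \<le> \<pi> a b \<and> \<pi> a b \<le> 1"
    and "simple_graph G" and "verts G = {1..num_verts G}"
    and "strictly_balanced G" and "num_edges G > 1" and "no_isolated_verts G"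
    and "l = measure_pmf.expectation (copies_pmf n Q \<pi> f G) real"
  shows "l = real (n choose num_verts G) * rho G * mu Q \<pi> f G \<and>
    d_TV (copies_pmf n Q \<pi> f G) (Po l) \<le>
      (1 - exp (- l)) * rho G *
        (2 * (real (num_verts G))\<^sup>2 / fact (num_verts G)
           * real n ^ (num_verts G - 1) * max_prob Q \<pi> ^ num_edges G
         + max_prob Q \<pi>
         + (\<Sum>s = 2..num_verts G - 1.
              real (num_verts G choose s)
                * (real n ^ (num_verts G - s) * max_prob Q \<pi> powr kappa G s)
                / fact (num_verts G - s)))"
proof
  interpret stochastic_block_model n Q f \<pi>
    by unfold_locales (use assms(2-6) in \<open>auto intro: less_imp_le\<close>)
  have e: "num_edges G > 0" using assms(10) by simp
  show "l = real (n choose num_verts G) * rho G * mu Q \<pi> f G"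
    unfolding assms(12) by (rule mean_copies[OF assms(7,8) e])
  have "l \<ge> 0" unfolding assms(12) by (intro integral_nonneg_AE) auto
  then consider "l = 0" | "l > 0" by linarith
  thus "d_TV (copies_pmf n Q \<pi> f G) (Po l) \<le>
      (1 - exp (- l)) * rho G *
        (2 * (real (num_verts G))\<^sup>2 / fact (num_verts G)
           * real n ^ (num_verts G - 1) * max_prob Q \<pi> ^ num_edges G
         + max_prob Q \<pi>
         + (\<Sum>s = 2..num_verts G - 1.
              real (num_verts G choose s)
                * (real n ^ (num_verts G - s) * max_prob Q \<pi> powr kappa G s)
                / fact (num_verts G - s)))"
  proof cases
    \<comment> \<open>For mean 0 both laws are the point mass at 0, and the right-hand side vanishes as well.\<close>
    case 1
    hence "copies_pmf n Q \<pi> f G = return_pmf 0"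
      using copies_pmf_mean_0[OF assms(7,8) e] assms(12) by simp
    thus ?thesis using 1 by (simp add: d_TV_def Po_def)
  next
    case 2
    thus ?thesis unfolding d_TV_def Po_def
      using copies_poisson_approximation[OF assms(7,8) e] assms(12)
      by (intro cSUP_least) auto
  qed
qed

end
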